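(* Let $M\in\mathbb{R}^{2n\times 2n}$ be symmetric positive-definite and let $1\le k\le n$. Consider the problem $\min_{X\in\mathbb{R}^{2n\times 2k}} f(X):=\mathrm{tr}(X^TMX)$ subject to $h(X):=X^TJ_{2n}X-J_{2k}=0$. (i) If $X_*\in\mathrm{Sp}(2k,2n)$ is a critical point of this problem, then for any $K\in\mathrm{OrSp}(2k)$ the matrix $X_*K$ is also a critical point of this problem. (ii) A matrix $X_*\in\mathrm{Sp}(2k,2n)$ is a critical point of this problem if and only if there exists $K\in\mathrm{OrSp}(2k)$ such that the columns of $X_*K$ form a normalized symplectic eigenvector set of $M$.
   Context: Let $J_{2n}=\begin{bmatrix}0&I_n\\-I_n&0\end{bmatrix}$. $\mathrm{Sp}(2k,2n)=\{X\in\mathbb{R}^{2n\times 2k}: X^TJ_{2n}X=J_{2k}\}$, $\mathrm{Sp}(2k)=\mathrm{Sp}(2k,2k)$, and $\mathrm{OrSp}(2k)$ is the set of matrices in $\mathrm{Sp}(2k)$ that are also orthogonal. Critical point: $X_*\in\mathbb{R}^{2n\times 2k}$ is a critical point of the problem if $h(X_* )=0$ and there is a skew-symmetric Lagrange multiplier $L_*\in\mathbb{R}^{2k\times 2k}$ with $MX_*=J_{2n}X_*L_*$ (equivalently, the gradient in $X$ of $\mathrm{tr}(X^TMX)-\mathrm{tr}(L(X^TJ_{2n}X-J_{2k}))$ vanishes at $(X_*,L_* )$). Symplectic eigenvalues: by Williamson's theorem there is $S\in\mathrm{Sp}(2n)$ with $S^TMS=\mathrm{diag}(D,D)$, $D=\mathrm{diag}(d_1,\dots,d_n)$,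 $0<d_1\le\dots\le d_n$; the $d_i$ (uniquely determined by $M$) are the symplectic eigenvalues of $M$. Normalized symplectic eigenvector set: the columns of $X\in\mathbb{R}^{2n\times 2k}$ form a normalized symplectic eigenvector set of $M$ associated with the symplectic eigenvalues $\lambda_1,\dots,\lambda_k$ if $X\in\mathrm{Sp}(2k,2n)$ and $MX=J_{2n}X\begin{bmatrix}0&-\Lambda\\\Lambda&0\end{bmatrix}$ with $\Lambda=\mathrm{diag}(\lambda_1,\dots,\lambda_k)$; they form a normalized symplectic eigenvector set of $M$ if this holds for some symplectic eigenvalues $\lambda_1,\dots,\lambda_k$ of $M$. *)

theory Defs
  imports Complex_Main "Jordan_Normal_Form.Matrix"
begin

definition J_mat :: "nat \<Rightarrow> real mat" where
  "J_mat n = four_block_mat (0\<^sub>m n n) (1\<^sub>m n) (- 1\<^sub>m n) (0\<^sub>m n n)"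

definition Sp :: "nat \<Rightarrow> nat \<Rightarrow> real mat set" where
  "Sp k n = {X \<in> carrier_mat (2 * n) (2 * k). X\<^sup>T * J_mat n * X = J_mat k}"

(* The library's orthogonal_mat only asks for pairwise orthogonal nonzero columns,
   so orthogonality is written out. *)
definition OrSp :: "nat \<Rightarrow> real mat set" where
  "OrSp k = {K \<in> Sp k k. K\<^sup>T * K = 1\<^sub>m (2 * k)}"

definition sym_pos_def :: "nat \<Rightarrow> real mat \<Rightarrow> bool" where
  "sym_pos_def m M \<longleftrightarrow> M \<in> carrier_mat m m \<and> M\<^sup>T = M \<and>
     (\<forall>v \<in> carrier_vec m. v \<noteq> 0\<^sub>v m \<longrightarrow> 0 < v \<bullet> (M *\<^sub>v v))"

definition mat_trace :: "real mat \<Rightarrow> real" where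
  "mat_trace A = (\<Sum>i<dim_row A. A $$ (i, i))"

definition objective :: "real mat \<Rightarrow> real mat \<Rightarrow> real" where
  "objective M X = mat_trace (X\<^sup>T * M * X)"

definition constraint :: "nat \<Rightarrow> nat \<Rightarrow> real mat \<Rightarrow> real mat" where
  "constraint k n X = X\<^sup>T * J_mat n * X - J_mat k"

definition lagrangian :: "nat \<Rightarrow> nat \<Rightarrow> real mat \<Rightarrow> real mat \<Rightarrow> real mat \<Rightarrow> real" where
  "lagrangian k n M X L = objective M X - mat_trace (L * constraint k n X)"

(* Critical points of: minimise objective M X subject to constraint k n X = 0.
   The multiplier equation is the vanishing of the X-gradient of the Lagrangian;
   see critical_point_iff_lagrangian_stationary below. *)
definition critical_point :: "nat \<Rightarrow> nat \<Rightarrow> real mat \<Rightarrow> real mat \<Rightarrow> bool" where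
  "critical_point k n M X \<longleftrightarrow> X \<in> carrier_mat (2 * n) (2 * k) \<and>
     constraint k n X = 0\<^sub>m (2 * k) (2 * k) \<and>
     (\<exists>L \<in> carrier_mat (2 * k) (2 * k). L\<^sup>T = - L \<and> M * X = J_mat n * X * L)"

(* d 0, ..., d (n - 1) are the symplectic eigenvalues of M in increasing order, repeated
   according to multiplicity; the values of d outside {..<n} are irrelevant. *)
definition symplectic_eigenvalues :: "nat \<Rightarrow> real mat \<Rightarrow> (nat \<Rightarrow> real) \<Rightarrow> bool" where
  "symplectic_eigenvalues n M d \<longleftrightarrow> (\<forall>i<n. 0 < d i) \<and> mono_on {..<n} d \<and>
     (\<exists>S \<in> Sp n n. S\<^sup>T * M * S =
        four_block_mat (mat_diag n d) (0\<^sub>m n n) (0\<^sub>m n n) (mat_diag n d))"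

definition symplectic_eigenvalue :: "nat \<Rightarrow> real mat \<Rightarrow> real \<Rightarrow> bool" where
  "symplectic_eigenvalue n M \<mu> \<longleftrightarrow> (\<exists>d. symplectic_eigenvalues n M d \<and> (\<exists>i<n. \<mu> = d i))"

definition normalized_symplectic_eigenvector_set_assoc ::
  "nat \<Rightarrow> nat \<Rightarrow> real mat \<Rightarrow> real mat \<Rightarrow> (nat \<Rightarrow> real) \<Rightarrow> bool" where
  "normalized_symplectic_eigenvector_set_assoc k n M X l \<longleftrightarrow> X \<in> Sp k n \<and>
     M * X = J_mat n * X *
       four_block_mat (0\<^sub>m k k) (- mat_diag k l) (mat_diag k l) (0\<^sub>m k k)"

(* Repetitions among the l i are allowed, as for ordinary eigenvectors: since X is symplectic,
   no value can occur more often than its multiplicity permits. *)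
definition normalized_symplectic_eigenvector_set ::
  "nat \<Rightarrow> nat \<Rightarrow> real mat \<Rightarrow> real mat \<Rightarrow> bool" where
  "normalized_symplectic_eigenvector_set k n M X \<longleftrightarrow>
     (\<exists>l. (\<forall>i<k. symplectic_eigenvalue n M (l i)) \<and>
          normalized_symplectic_eigenvector_set_assoc k n M X l)"

lemma J_mat_carrier [simp]: "J_mat n \<in> carrier_mat (2 * n) (2 * n)"
  unfolding J_mat_def by (metis four_block_carrier_mat mult_2 one_carrier_mat zero_carrier_mat)

lemma J_mat_transpose: "(J_mat n)\<^sup>T = - J_mat n"
  unfolding J_mat_def four_block_mat_def
  by (rule eq_matI) (auto simp: Let_def)

lemma mat_trace_add:
  assumes "A \<in> carrier_mat m m" "B \<in> carrier_mat m m"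
  shows "mat_trace (A + B) = mat_trace A + mat_trace B"
  using assms unfolding mat_trace_def by (simp add: sum.distrib)

lemma mat_trace_minus:
  assumes "A \<in> carrier_mat m m" "B \<in> carrier_mat m m"
  shows "mat_trace (A - B) = mat_trace A - mat_trace B"
  using assms unfolding mat_trace_def by (simp add: sum_subtractf)

lemma mat_trace_uminus:
  assumes "A \<in> carrier_mat m m"
  shows "mat_trace (- A) = - mat_trace A"
  using assms unfolding mat_trace_def by (simp add: sum_negf)

lemma mat_trace_smult:
  assumes "A \<in> carrier_mat m m"
  shows "mat_trace (c \<cdot>\<^sub>m A) = c * mat_trace A"
  using assms unfolding mat_trace_def by (simp add: sum_distrib_left)

lemma mat_trace_transpose:
  assumes "A \<in> carrier_mat m m"
  shows "mat_trace A\<^sup>T = mat_trace A"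
  using assms unfolding mat_trace_def by simp

lemma mat_trace_comm:
  assumes "A \<in> carrier_mat m p" "B \<in> carrier_mat p m"
  shows "mat_trace (A * B) = mat_trace (B * A)"
proof -
  have "mat_trace (A * B) = (\<Sum>i<m. \<Sum>j<p. A $$ (i, j) * B $$ (j, i))"
    using assms unfolding mat_trace_def by (simp add: scalar_prod_def lessThan_atLeast0)
  also have "\<dots> = (\<Sum>j<p. \<Sum>i<m. B $$ (j, i) * A $$ (i, j))"
    by (subst sum.swap) (simp add: mult.commute)
  also have "\<dots> = mat_trace (B * A)"
    using assms unfolding mat_trace_def by (simp add: scalar_prod_def lessThan_atLeast0)
  finally show ?thesis .
qed

lemma mat_trace_gram_eq_0:
  assumes A: "A \<in> carrier_mat m p" and 0: "mat_trace (A\<^sup>T * A) = 0"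
  shows "A = 0\<^sub>m m p"
proof -
  have "mat_trace (A\<^sup>T * A) = (\<Sum>i<p. \<Sum>j<m. (A $$ (j, i))\<^sup>2)"
    using A unfolding mat_trace_def
    by (simp add: scalar_prod_def lessThan_atLeast0 power2_eq_square)
  with 0 have "\<forall>i<p. \<forall>j<m. A $$ (j, i) = 0"
    by (simp add: sum_nonneg_eq_0_iff sum_nonneg)
  with A show ?thesis by (intro eq_matI) auto
qed

lemma quadratic_expand:
  fixes A X Z :: "real mat"
  assumes A: "A \<in> carrier_mat m m" and X: "X \<in> carrier_mat m p" and Z: "Z \<in> carrier_mat m p"
  shows "(X + t \<cdot>\<^sub>m Z)\<^sup>T * A * (X + t \<cdot>\<^sub>m Z) =
    X\<^sup>T * A * X + t \<cdot>\<^sub>m (X\<^sup>T * A * Z + Z\<^sup>T * A * X) + t\<^sup>2 \<cdot>\<^sub>m (Z\<^sup>T * A * Z)"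
proof -
  have tr: "(X + t \<cdot>\<^sub>m Z)\<^sup>T = X\<^sup>T + t \<cdot>\<^sub>m Z\<^sup>T"
    using X Z by (intro eq_matI) auto
  have c: "X\<^sup>T * A \<in> carrier_mat p m" "Z\<^sup>T * A \<in> carrier_mat p m" using A X Z by auto
  have "(X + t \<cdot>\<^sub>m Z)\<^sup>T * A = X\<^sup>T * A + t \<cdot>\<^sub>m (Z\<^sup>T * A)"
    unfolding tr using A X Z
    by (simp add: add_mult_distrib_mat[of _ p m _ _ m] mult_smult_assoc_mat[of _ p m _ m])
  also have "\<dots> * (X + t \<cdot>\<^sub>m Z) =
      (X\<^sup>T * A) * (X + t \<cdot>\<^sub>m Z) + (t \<cdot>\<^sub>m (Z\<^sup>T * A)) * (X + t \<cdot>\<^sub>m Z)"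
    using c X Z by (intro add_mult_distrib_mat[of _ p m _ _ p]) auto
  also have "(X\<^sup>T * A) * (X + t \<cdot>\<^sub>m Z) = X\<^sup>T * A * X + t \<cdot>\<^sub>m (X\<^sup>T * A * Z)"
    using c X Z
    by (simp add: mult_add_distrib_mat[of _ p m _ p] mult_smult_distrib[of _ p m _ p])
  also have "(t \<cdot>\<^sub>m (Z\<^sup>T * A)) * (X + t \<cdot>\<^sub>m Z) =
      t \<cdot>\<^sub>m (Z\<^sup>T * A * X + t \<cdot>\<^sub>m (Z\<^sup>T * A * Z))"
    using c X Z
    by (simp add: mult_smult_assoc_mat[of _ p m _ p] mult_add_distrib_mat[of _ p m _ p]
        mult_smult_distrib[of _ p m _ p] add_smult_distrib_left_mat[of _ p p])
  finally show ?thesis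
    by (simp only:) (rule eq_matI, insert A X Z, auto simp: algebra_simps power2_eq_square
        simp del: index_mult_mat(1))
qed

lemma lagrangian_derivative:
  assumes M: "M \<in> carrier_mat (2 * n) (2 * n)" "M\<^sup>T = M"
    and X: "X \<in> carrier_mat (2 * n) (2 * k)" and Z: "Z \<in> carrier_mat (2 * n) (2 * k)"
    and L: "L \<in> carrier_mat (2 * k) (2 * k)" "L\<^sup>T = - L"
  shows "((\<lambda>t. lagrangian k n M (X + t \<cdot>\<^sub>m Z) L) has_real_derivative
      2 * mat_trace (Z\<^sup>T * (M * X - J_mat n * X * L))) (at 0)"
proof -
  let ?J = "J_mat n" let ?n = "2 * n" let ?k = "2 * k"
  let ?P = "\<lambda>A. X\<^sup>T * A * Z + Z\<^sup>T * A * X"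
  have kk: "X\<^sup>T * A * X \<in> carrier_mat ?k ?k" "Z\<^sup>T * A * Z \<in> carrier_mat ?k ?k"
    "X\<^sup>T * A * Z \<in> carrier_mat ?k ?k" "Z\<^sup>T * A * X \<in> carrier_mat ?k ?k"
    if "A \<in> carrier_mat ?n ?n" for A
    using that X Z by (meson mult_carrier_mat transpose_carrier_mat)+
  note kM = kk[OF M(1)] and kJ = kk[OF J_mat_carrier]
  have obj: "objective M (X + t \<cdot>\<^sub>m Z) =
      mat_trace (X\<^sup>T * M * X) + t * mat_trace (?P M) + t\<^sup>2 * mat_trace (Z\<^sup>T * M * Z)" for t
    unfolding objective_def quadratic_expand[OF M(1) X Z] using kM
    by (simp add: mat_trace_add[of _ ?k] mat_trace_smult[of _ ?k])
  have con: "L * constraint k n (X + t \<cdot>\<^sub>m Z) =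
      L * (X\<^sup>T * ?J * X) + t \<cdot>\<^sub>m (L * ?P ?J) + t\<^sup>2 \<cdot>\<^sub>m (L * (Z\<^sup>T * ?J * Z)) - L * J_mat k" for t
    unfolding constraint_def quadratic_expand[OF J_mat_carrier X Z] using kJ L
    by (simp add: mult_minus_distrib_mat[of _ ?k ?k _ ?k] mult_add_distrib_mat[of _ ?k ?k _ ?k]
        mult_smult_distrib[of _ ?k ?k _ ?k] assoc_add_mat[of _ ?k ?k])
  have lk: "L * A \<in> carrier_mat ?k ?k" if "A \<in> carrier_mat ?k ?k" for A
    using L that by auto
  have P: "?P ?J \<in> carrier_mat ?k ?k" using kJ by auto
  note lks = lk[OF kJ(1)] lk[OF kJ(2)] lk[OF P] lk[OF J_mat_carrier]
  have tcon: "mat_trace (L * constraint k n (X + t \<cdot>\<^sub>m Z)) =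
      mat_trace (L * (X\<^sup>T * ?J * X)) + t * mat_trace (L * ?P ?J)
      + t\<^sup>2 * mat_trace (L * (Z\<^sup>T * ?J * Z)) - mat_trace (L * J_mat k)" for t
    unfolding con using lks
    by (simp add: mat_trace_minus[of _ ?k] mat_trace_add[of _ ?k] mat_trace_smult[of _ ?k])
  have "((\<lambda>t. lagrangian k n M (X + t \<cdot>\<^sub>m Z) L) has_real_derivative
      (mat_trace (?P M) - mat_trace (L * ?P ?J))) (at 0)"
    unfolding lagrangian_def obj tcon by (auto intro!: derivative_eq_intros)
  moreover have "mat_trace (?P M) = 2 * mat_trace (Z\<^sup>T * (M * X))"
  proof -
    have a: "Z\<^sup>T * M * X = Z\<^sup>T * (M * X)"
      using M X Z by (intro assoc_mult_mat) auto
    have "(X\<^sup>T * M * Z)\<^sup>T = Z\<^sup>T * (X\<^sup>T * M)\<^sup>T"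
      by (rule transpose_mult[of _ ?k ?n _ ?k]) (use M X Z in auto)
    also have "(X\<^sup>T * M)\<^sup>T = M * X"
      using transpose_mult[of "X\<^sup>T" ?k ?n M ?n] M X by simp
    finally have "mat_trace (X\<^sup>T * M * Z) = mat_trace (Z\<^sup>T * (M * X))"
      using mat_trace_transpose[OF kM(3)] by simp
    then show ?thesis using kM mat_trace_add[OF kM(3) kM(4)] a by simp
  qed
  moreover have "mat_trace (L * ?P ?J) = 2 * mat_trace (Z\<^sup>T * (?J * X * L))"
  proof -
    have JX: "?J * X \<in> carrier_mat ?n ?k" using X by (meson J_mat_carrier mult_carrier_mat)
    have a: "Z\<^sup>T * ?J * X = Z\<^sup>T * (?J * X)"
      by (rule assoc_mult_mat[of _ ?k ?n _ ?n _ ?k]) (use X Z in auto)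
    have b: "Z\<^sup>T * (?J * X) * L = Z\<^sup>T * (?J * X * L)"
      by (rule assoc_mult_mat[of _ ?k ?n _ ?k _ ?k]) (use JX Z L in auto)
    have 1: "mat_trace (L * (Z\<^sup>T * ?J * X)) = mat_trace (Z\<^sup>T * (?J * X * L))"
      using mat_trace_comm[OF L(1) kJ(4)] a b by simp
    have "(X\<^sup>T * ?J)\<^sup>T = - ?J * X"
      using transpose_mult[of "X\<^sup>T" ?k ?n ?J ?n] X by (simp add: J_mat_transpose)
    also have "\<dots> = - (?J * X)" using X by (metis J_mat_carrier carrier_matD uminus_mult_left_mat)
    finally have c: "(X\<^sup>T * ?J)\<^sup>T = - (?J * X)" .
    have "(X\<^sup>T * ?J * Z)\<^sup>T = Z\<^sup>T * (X\<^sup>T * ?J)\<^sup>T"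
      by (rule transpose_mult[of _ ?k ?n _ ?k]) (use X Z in \<open>auto intro!: mult_carrier_mat[of _ _ ?n]\<close>)
    also have "\<dots> = - (Z\<^sup>T * ?J * X)"
      unfolding c a using JX Z by (metis carrier_matD index_transpose_mat(3) uminus_mult_right_mat)
    finally have d: "(X\<^sup>T * ?J * Z)\<^sup>T = - (Z\<^sup>T * ?J * X)" .
    have "(L * (X\<^sup>T * ?J * Z))\<^sup>T = - (Z\<^sup>T * ?J * X) * - L"
      using transpose_mult[OF L(1) kJ(3)] d L(2) by simp
    also have "\<dots> = Z\<^sup>T * ?J * X * L"
      using kJ(4) L(1) by (simp del: index_mult_mat add: uminus_mult_left_mat uminus_mult_right_mat)
    finally have "mat_trace (L * (X\<^sup>T * ?J * Z)) = mat_trace (Z\<^sup>T * (?J * X * L))"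
      using mat_trace_transpose[OF lk[OF kJ(3)]] a b by simp
    then show ?thesis
      using 1 mult_add_distrib_mat[OF L(1) kJ(3) kJ(4)] mat_trace_add[OF lk[OF kJ(3)] lk[OF kJ(4)]]
      by simp
  qed
  moreover have "mat_trace (Z\<^sup>T * (M * X - ?J * X * L)) =
      mat_trace (Z\<^sup>T * (M * X)) - mat_trace (Z\<^sup>T * (?J * X * L))"
  proof -
    have c: "M * X \<in> carrier_mat ?n ?k" "?J * X * L \<in> carrier_mat ?n ?k"
      using M X L by (meson J_mat_carrier mult_carrier_mat)+
    have Zt: "Z\<^sup>T \<in> carrier_mat ?k ?n" using Z by simp
    show ?thesis
      using mult_minus_distrib_mat[OF Zt c] mat_trace_minus Zt c by (metis mult_carrier_mat)
  qed
  ultimately show ?thesis by (simp add: right_diff_distrib)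
qed

lemma critical_point_iff_lagrangian_stationary:
  assumes M: "M \<in> carrier_mat (2 * n) (2 * n)" "M\<^sup>T = M"
  shows "critical_point k n M X \<longleftrightarrow> X \<in> carrier_mat (2 * n) (2 * k) \<and>
     constraint k n X = 0\<^sub>m (2 * k) (2 * k) \<and>
     (\<exists>L \<in> carrier_mat (2 * k) (2 * k). L\<^sup>T = - L \<and>
       (\<forall>Z \<in> carrier_mat (2 * n) (2 * k).
         ((\<lambda>t. lagrangian k n M (X + t \<cdot>\<^sub>m Z) L) has_real_derivative 0) (at 0)))"
proof -
  have "M * X = J_mat n * X * L \<longleftrightarrow> (\<forall>Z \<in> carrier_mat (2 * n) (2 * k).
         ((\<lambda>t. lagrangian k n M (X + t \<cdot>\<^sub>m Z) L) has_real_derivative 0) (at 0))"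
    (is "?l \<longleftrightarrow> ?r")
    if X: "X \<in> carrier_mat (2 * n) (2 * k)" and L: "L \<in> carrier_mat (2 * k) (2 * k)" "L\<^sup>T = - L"
    for L
  proof
    let ?G = "M * X - J_mat n * X * L"
    have c: "M * X \<in> carrier_mat (2 * n) (2 * k)" "J_mat n * X * L \<in> carrier_mat (2 * n) (2 * k)"
      using M X L by (meson J_mat_carrier mult_carrier_mat)+
    then have G: "?G \<in> carrier_mat (2 * n) (2 * k)" by (rule_tac minus_carrier_mat)
    note der = lagrangian_derivative[OF M X _ L]
    {
      assume ?l
      then have 0: "?G = 0\<^sub>m (2 * n) (2 * k)" using c by auto
      show ?r
      proof
        fix Z :: "real mat" assume Z: "Z \<in> carrier_mat (2 * n) (2 * k)"
        have "Z\<^sup>T * ?G = 0\<^sub>m (2 * k) (2 * k)" unfolding 0 using Z by simp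
        then have "mat_trace (Z\<^sup>T * ?G) = 0" by (simp add: mat_trace_def)
        with der[OF Z] show "((\<lambda>t. lagrangian k n M (X + t \<cdot>\<^sub>m Z) L) has_real_derivative 0) (at 0)"
          by simp
      qed
    next
      assume ?r
      with der[OF G] G have "mat_trace (?G\<^sup>T * ?G) = 0"
        using DERIV_unique by fastforce
      from mat_trace_gram_eq_0[OF G this] have 0: "?G = 0\<^sub>m (2 * n) (2 * k)" .
      show ?l
      proof (rule eq_matI)
        fix i j assume ij: "i < dim_row (J_mat n * X * L)" "j < dim_col (J_mat n * X * L)"
        have "?G $$ (i, j) = 0" unfolding 0 using ij carrier_matD[OF c(2)] by (simp del: index_mult_mat)
        moreover have "?G $$ (i, j) = (M * X) $$ (i, j) - (J_mat n * X * L) $$ (i, j)"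
          using ij by (intro index_minus_mat)
        ultimately show "(M * X) $$ (i, j) = (J_mat n * X * L) $$ (i, j)" by linarith
      qed (use carrier_matD[OF c(1)] carrier_matD[OF c(2)] in simp_all)
    }
  qed
  then show ?thesis unfolding critical_point_def by blast
qed

end

theory Submission
  imports Defs "Jordan_Normal_Form.Determinant"
    "HOL-Computational_Algebra.Fundamental_Theorem_Algebra"
begin

text \<open>If \<open>M X = J X L\<close> with \<open>L\<close> skew, then \<open>W = X\<^sup>T M X = J L\<close> is symmetric positive definite and
  commutes with \<open>J\<close>. Williamson's theorem gives a symplectic \<open>S\<close> with \<open>S\<^sup>T W S = D \<oplus> D\<close>, and
  because \<open>W\<close> commutes with \<open>J\<close> this \<open>S\<close> is automatically orthogonal; \<open>X S\<close> is then a normalized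
  symplectic eigenvector set. The entries of \<open>D\<close> are symplectic eigenvalues of \<open>M\<close>: in a
  Williamson basis of \<open>M\<close> the eigenvector equation, applied twice, compares squares of diagonal
  entries. Williamson's theorem itself is obtained by splitting off one symplectic pair at a time,
  from a complex eigenvector of \<open>J\<inverse> M\<close> in the symplectic complement of the pairs already
  found.\<close>

section \<open>Eigenvectors in invariant subspaces\<close>

text \<open>Padding \<open>A\<close> with zero rows gives a square matrix \<open>B\<close> whose row
  \<open>r\<close> vanishes. Then \<open>unit_vec m r\<close> lies in the kernel of
  \<open>B\<^sup>T\<close>, so \<open>B\<close> is singular, and a kernel vector of \<open>B\<close>
  is one of \<open>A\<close>.\<close>

lemma ex_kernel_vec:
  fixes A :: "'a :: field mat"
  assumes A: "A \<in> carrier_mat r m" and "r < m"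
  obtains v where "v \<in> carrier_vec m" "v \<noteq> 0\<^sub>v m" "A *\<^sub>v v = 0\<^sub>v r"
proof -
  define B where "B = mat m m (\<lambda>(i, j). if i < r then A $$ (i, j) else 0)"
  have B: "B \<in> carrier_mat m m" by (simp add: B_def)
  have "B\<^sup>T *\<^sub>v unit_vec m r = 0\<^sub>v m"
  proof (rule eq_vecI)
    fix i assume "i < dim_vec (0\<^sub>v m :: 'a vec)"
    then show "(B\<^sup>T *\<^sub>v unit_vec m r) $ i = 0\<^sub>v m $ i"
      using B \<open>r < m\<close> by (simp add: B_def)
  qed (use B in simp)
  moreover have "unit_vec m r \<noteq> (0\<^sub>v m :: 'a vec)" using \<open>r < m\<close> by simp
  ultimately have "det B\<^sup>T = 0"
    using det_0_iff_vec_prod_zero[of "B\<^sup>T" m] B unit_vec_carrier transpose_carrier_mat by blast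
  then have "det B = 0" using det_transpose[OF B] by simp
  then obtain v where v: "v \<in> carrier_vec m" "v \<noteq> 0\<^sub>v m" "B *\<^sub>v v = 0\<^sub>v m"
    using det_0_iff_vec_prod_zero[OF B] by blast
  have "A *\<^sub>v v = 0\<^sub>v r"
  proof (rule eq_vecI)
    fix i assume "i < dim_vec (0\<^sub>v r :: 'a vec)"
    then have i: "i < r" by simp
    have "row A i = row B i" using i A \<open>r < m\<close> by (intro eq_vecI) (auto simp: B_def)
    then have "(A *\<^sub>v v) $ i = (B *\<^sub>v v) $ i" using i A B \<open>r < m\<close> by simp
    then show "(A *\<^sub>v v) $ i = 0\<^sub>v r $ i" using v(3) i \<open>r < m\<close> by simp
  qed (use A in simp)
  with v show thesis using that by blast
qed

text \<open>Splitting off the linear factors of an annihilating polynomial one by one, the vector stays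
  in the invariant set until it becomes an eigenvector.\<close>

lemma annihilated_imp_eigenvector:
  fixes A :: "complex mat"
  assumes A: "A \<in> carrier_mat m m"
    and closed: "\<And>v c. v \<in> carrier_vec m \<Longrightarrow> P v \<Longrightarrow> P (A *\<^sub>v v - c \<cdot>\<^sub>v v)"
    and "z \<in> carrier_vec m" "P z" "z \<noteq> 0\<^sub>v m" "p \<noteq> 0"
    and "\<And>i. i < m \<Longrightarrow> (\<Sum>j\<le>degree p. coeff p j * ((A ^\<^sub>m j) *\<^sub>v z) $ i) = 0"
  shows "\<exists>v \<in> carrier_vec m. P v \<and> v \<noteq> 0\<^sub>v m \<and> (\<exists>\<mu>. A *\<^sub>v v = \<mu> \<cdot>\<^sub>v v)"
  using assms(3-)
proof (induction "degree p" arbitrary: p z)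
  case 0
  have "z $ i = 0" if "i < m" for i
    using 0(6)[OF that] 0(1,2,5) A by (auto elim: degree_eq_zeroE)
  then have "z = 0\<^sub>v m" using 0(2) by (intro eq_vecI) auto
  with 0(4) show ?case by simp
next
  case (Suc d)
  have "\<not> constant (poly p)" using Suc(2) by (simp add: constant_degree)
  then obtain \<mu> where "poly p \<mu> = 0" using fundamental_theorem_of_algebra by blast
  then obtain q where p: "p = [:-\<mu>, 1:] * q" unfolding poly_eq_0_iff_dvd by (elim dvdE)
  with Suc(6) have q: "q \<noteq> 0" by auto
  have "degree p = degree [:-\<mu>, 1:] + degree q" unfolding p using q by (intro degree_mult_eq) auto
  then have d: "d = degree q" using Suc(2) by simp
  define w where "w = A *\<^sub>v z - \<mu> \<cdot>\<^sub>v z"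
  have w: "w \<in> carrier_vec m" "P w" using A Suc(3) closed[OF Suc(3,4)] by (auto simp: w_def)
  show ?case
  proof (cases "w = 0\<^sub>v m")
    case True
    have "A *\<^sub>v z = \<mu> \<cdot>\<^sub>v z"
    proof (rule eq_vecI)
      fix i assume "i < dim_vec (\<mu> \<cdot>\<^sub>v z)"
      then have "i < m" using Suc(3) by simp
      then have "w $ i = 0" using True by simp
      then show "(A *\<^sub>v z) $ i = (\<mu> \<cdot>\<^sub>v z) $ i" using \<open>i < m\<close> Suc(3) by (simp add: w_def)
    qed (use A Suc(3) in simp)
    with Suc(3,4,5) show ?thesis by blast
  next
    case False
    have "(\<Sum>j\<le>degree q. coeff q j * ((A ^\<^sub>m j) *\<^sub>v w) $ i) = 0" if "i < m" for i
    proof -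
      let ?f = "\<lambda>j. ((A ^\<^sub>m j) *\<^sub>v z) $ i"
      have step: "((A ^\<^sub>m j) *\<^sub>v w) $ i = ?f (Suc j) - \<mu> * ?f j" for j
      proof -
        have Aj: "A ^\<^sub>m j \<in> carrier_mat m m" using A by simp
        have "(A ^\<^sub>m j) *\<^sub>v w = (A ^\<^sub>m j) *\<^sub>v (A *\<^sub>v z) - \<mu> \<cdot>\<^sub>v ((A ^\<^sub>m j) *\<^sub>v z)"
          unfolding w_def using Aj A Suc(3)
          by (simp add: mult_minus_distrib_mat_vec[of _ m m] mult_mat_vec[of _ m m])
        also have "(A ^\<^sub>m j) *\<^sub>v (A *\<^sub>v z) = (A ^\<^sub>m Suc j) *\<^sub>v z"
          using Aj A Suc(3) by (simp add: assoc_mult_mat_vec[of _ m m _ m])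
        finally show ?thesis using that Aj A by simp
      qed
      have "0 = (\<Sum>j\<le>Suc d. coeff p j * ?f j)" using Suc(7)[OF that] Suc(2) by simp
      \<comment> \<open>As a polynomial, \<open>p\<close> is the shift \<open>pCons 0 q\<close>
        minus \<mu> times \<open>q\<close>. The shift has no constant term and \<open>q\<close> has
        no coefficient at \<open>Suc d\<close>, so both sums become sums over j \<le> d.\<close>
      also have "\<dots> = (\<Sum>j\<le>Suc d. coeff (pCons 0 q) j * ?f j) - \<mu> * (\<Sum>j\<le>Suc d. coeff q j * ?f j)"
        unfolding p by (simp add: algebra_simps sum.distrib sum_subtractf sum_distrib_left
            del: sum.atMost_Suc)
      also have "(\<Sum>j\<le>Suc d. coeff (pCons 0 q) j * ?f j) = (\<Sum>j\<le>d. coeff q j * ?f (Suc j))"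
        by (simp add: sum.atMost_Suc_shift del: sum.atMost_Suc)
      also have "(\<Sum>j\<le>Suc d. coeff q j * ?f j) = (\<Sum>j\<le>d. coeff q j * ?f j)"
        using d by (simp add: coeff_eq_0)
      finally show ?thesis
        unfolding step d[symmetric] by (simp add: algebra_simps sum_subtractf sum_distrib_left)
    qed
    then show ?thesis using Suc(1)[OF d w False q] by blast
  qed
qed

text \<open>Over the complex numbers, the vectors with real and imaginary parts in \<open>C\<close>
  stay of this kind under \<open>A\<close> minus any scalar, so
  \<open>annihilated_imp_eigenvector\<close> applies with this property as \<open>P\<close>. An
  eigenvector x + iy for the eigenvalue a + ib, split into real and imaginary parts, is the pair in
  the conclusion.\<close>

lemma invariant_subspace_eigenpair:
  fixes A :: "real mat"
  assumes A: "A \<in> carrier_mat m m" and C: "C \<subseteq> carrier_vec m"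
    and add: "\<And>u v. u \<in> C \<Longrightarrow> v \<in> C \<Longrightarrow> u + v \<in> C"
    and smult: "\<And>c v. v \<in> C \<Longrightarrow> c \<cdot>\<^sub>v v \<in> C"
    and inv: "\<And>v. v \<in> C \<Longrightarrow> A *\<^sub>v v \<in> C"
    and w: "w \<in> C" "w \<noteq> 0\<^sub>v m"
  obtains x y a b where "x \<in> C" "y \<in> C" "x \<noteq> 0\<^sub>v m \<or> y \<noteq> 0\<^sub>v m"
    "A *\<^sub>v x = a \<cdot>\<^sub>v x - b \<cdot>\<^sub>v y" "A *\<^sub>v y = b \<cdot>\<^sub>v x + a \<cdot>\<^sub>v y"
proof -
  define B where "B = map_mat complex_of_real A"
  have B: "B \<in> carrier_mat m m" using A by (simp add: B_def)
  define P where "P z \<longleftrightarrow> map_vec Re z \<in> C \<and> map_vec Im z \<in> C" for z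
  define z where "z = map_vec complex_of_real w"
  have wm: "w \<in> carrier_vec m" using w C by auto
  have Re_B: "map_vec Re (B *\<^sub>v v) = A *\<^sub>v map_vec Re v"
    and Im_B: "map_vec Im (B *\<^sub>v v) = A *\<^sub>v map_vec Im v" if "v \<in> carrier_vec m" for v
    using that A by (intro eq_vecI; simp add: B_def scalar_prod_def)+
  have closed: "P (B *\<^sub>v v - c \<cdot>\<^sub>v v)" if v: "v \<in> carrier_vec m" and Pv: "P v" for v c
  proof -
    let ?x = "map_vec Re v" and ?y = "map_vec Im v"
    have xy: "?x \<in> C" "?y \<in> C" using Pv by (auto simp: P_def)
    have "map_vec Re (B *\<^sub>v v - c \<cdot>\<^sub>v v) = map_vec Re (B *\<^sub>v v) + ((- Re c) \<cdot>\<^sub>v ?x + Im c \<cdot>\<^sub>v ?y)"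
      using v B by (intro eq_vecI) auto
    moreover have "map_vec Im (B *\<^sub>v v - c \<cdot>\<^sub>v v) =
        map_vec Im (B *\<^sub>v v) + ((- Re c) \<cdot>\<^sub>v ?y + (- Im c) \<cdot>\<^sub>v ?x)"
      using v B by (intro eq_vecI) auto
    ultimately show ?thesis
      unfolding P_def using Re_B[OF v] Im_B[OF v] xy by (simp add: add smult inv)
  qed
  \<comment> \<open>The zero imaginary part lies in \<open>C\<close> as a multiple of
    \<open>w\<close>.\<close>
  have "map_vec Re z = w" "map_vec Im z = 0 \<cdot>\<^sub>v w" by (auto simp: z_def)
  then have z: "z \<in> carrier_vec m" "P z" using wm w smult[of w 0] by (auto simp: z_def P_def)
  have z0: "z \<noteq> 0\<^sub>v m"
  proof
    assume "z = 0\<^sub>v m"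
    then have "w = 0\<^sub>v m" using \<open>map_vec Re z = w\<close> by (auto intro!: eq_vecI)
    with w show False by simp
  qed
  \<comment> \<open>The columns are the m + 1 Krylov vectors of \<open>z\<close>. A kernel vector of
    \<open>K\<close> therefore lists the coefficients of a polynomial of degree at most m that
    annihilates \<open>z\<close>.\<close>
  define K where "K = mat m (Suc m) (\<lambda>(i, j). ((B ^\<^sub>m j) *\<^sub>v z) $ i)"
  have "K \<in> carrier_mat m (Suc m)" by (simp add: K_def)
  from ex_kernel_vec[OF this] obtain c where
    c: "c \<in> carrier_vec (Suc m)" "c \<noteq> 0\<^sub>v (Suc m)" "K *\<^sub>v c = 0\<^sub>v m" by auto
  define p where "p = (\<Sum>j\<le>m. monom (c $ j) j)"
  have p: "coeff p j = (if j \<le> m then c $ j else 0)" for j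
    by (simp add: p_def coeff_sum if_distrib[of "\<lambda>q. coeff q j"] cong: if_cong)
  have "p \<noteq> 0"
  proof
    assume "p = 0"
    then have "c $ j = 0" if "j \<le> m" for j using p[of j] that by simp
    then have "c = 0\<^sub>v (Suc m)" using c(1) by (intro eq_vecI) auto
    with c(2) show False by simp
  qed
  have deg: "degree p \<le> m" by (rule degree_le) (simp add: p)
  have "(\<Sum>j\<le>degree p. coeff p j * ((B ^\<^sub>m j) *\<^sub>v z) $ i) = 0" if i: "i < m" for i
  proof -
    have "(\<Sum>j\<le>degree p. coeff p j * ((B ^\<^sub>m j) *\<^sub>v z) $ i) =
        (\<Sum>j\<le>m. coeff p j * ((B ^\<^sub>m j) *\<^sub>v z) $ i)"
      using deg by (intro sum.mono_neutral_left) (auto simp: coeff_eq_0)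
    also have "\<dots> = (\<Sum>j\<in>{0..<Suc m}. K $$ (i, j) * c $ j)"
      using i by (intro sum.cong) (auto simp: p K_def)
    also have "\<dots> = (K *\<^sub>v c) $ i"
      using i c(1) by (auto simp: K_def scalar_prod_def intro!: sum.cong)
    finally show ?thesis using c(3) i by simp
  qed
  from annihilated_imp_eigenvector[of B m P, OF B closed z z0 \<open>p \<noteq> 0\<close> this]
  obtain v \<mu> where v: "v \<in> carrier_vec m" "P v" "v \<noteq> 0\<^sub>v m" "B *\<^sub>v v = \<mu> \<cdot>\<^sub>v v" by auto
  let ?x = "map_vec Re v" and ?y = "map_vec Im v"
  show thesis
  proof (rule that[of ?x ?y "Re \<mu>" "Im \<mu>"])
    show "?x \<in> C" "?y \<in> C" using v(2) by (auto simp: P_def)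
    show "?x \<noteq> 0\<^sub>v m \<or> ?y \<noteq> 0\<^sub>v m"
    proof (rule ccontr)
      assume "\<not> ?thesis"
      then have *: "?x = 0\<^sub>v m" "?y = 0\<^sub>v m" by auto
      have "v $ i = 0" if "i < m" for i
        using arg_cong[OF *(1), of "\<lambda>u. u $ i"] arg_cong[OF *(2), of "\<lambda>u. u $ i"] that v(1)
        by (simp add: complex_eq_iff)
      then have "v = 0\<^sub>v m" using v(1) by (intro eq_vecI) auto
      with v(3) show False by simp
    qed
    show "A *\<^sub>v ?x = Re \<mu> \<cdot>\<^sub>v ?x - Im \<mu> \<cdot>\<^sub>v ?y"
      unfolding Re_B[OF v(1), symmetric] v(4) using v(1) by (intro eq_vecI) auto
    show "A *\<^sub>v ?y = Im \<mu> \<cdot>\<^sub>v ?x + Re \<mu> \<cdot>\<^sub>v ?y"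
      unfolding Im_B[OF v(1), symmetric] v(4) using v(1) by (intro eq_vecI) auto
  qed
qed

section \<open>Williamson's theorem\<close>

lemma mult_mat_vec_adjoint:
  fixes A :: "real mat"
  assumes "A \<in> carrier_mat r c" "u \<in> carrier_vec c" "v \<in> carrier_vec r"
  shows "(A *\<^sub>v u) \<bullet> v = u \<bullet> (A\<^sup>T *\<^sub>v v)"
  using transpose_vec_mult_scalar[OF assms] assms
  by (metis comm_scalar_prod mult_mat_vec_carrier transpose_carrier_mat)

lemma index_gram:
  fixes A X :: "real mat"
  assumes "A \<in> carrier_mat m m" "X \<in> carrier_mat m p" "i < p" "j < p"
  shows "(X\<^sup>T * A * X) $$ (i, j) = col X i \<bullet> (A *\<^sub>v col X j)"
proof -
  have "X\<^sup>T * A * X = X\<^sup>T * (A * X)"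
    using assms by (intro assoc_mult_mat[of _ p m _ m _ p]) auto
  moreover have "col (A * X) j = A *\<^sub>v col X j" using assms by (intro eq_vecI) auto
  ultimately show ?thesis using assms by simp
qed

section \<open>The matrix J and the standard symplectic form\<close>

lemma J_mat_dim [simp]: "dim_row (J_mat n) = 2 * n" "dim_col (J_mat n) = 2 * n"
  using J_mat_carrier[of n] by (simp_all del: J_mat_carrier)

lemma J_mat_index:
  assumes "i < 2 * n" "j < 2 * n"
  shows "J_mat n $$ (i, j) =
    (if i < n then if j = i + n then 1 else 0 else if i = j + n then - 1 else 0)"
  using assms unfolding J_mat_def by auto

lemma J_mat_sq: "J_mat n * J_mat n = - 1\<^sub>m (2 * n)"
proof (rule eq_matI)
  fix i j assume "i < dim_row (- 1\<^sub>m (2 * n))" "j < dim_col (- 1\<^sub>m (2 * n))"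
  then have ij: "i < 2 * n" "j < 2 * n" by auto
  \<comment> \<open>The position of the only nonzero entry in row \<open>i\<close> of
    \<open>J_mat n\<close>.\<close>
  let ?k = "if i < n then i + n else i - n"
  have "(J_mat n * J_mat n) $$ (i, j) = (\<Sum>k\<in>{0..<2 * n}. J_mat n $$ (i, k) * J_mat n $$ (k, j))"
    using ij by (simp add: scalar_prod_def)
  also have "\<dots> = (\<Sum>k\<in>{?k}. J_mat n $$ (i, k) * J_mat n $$ (k, j))"
    using ij by (intro sum.mono_neutral_right) (auto simp: J_mat_index)
  also have "\<dots> = (- 1\<^sub>m (2 * n)) $$ (i, j)" using ij by (auto simp: J_mat_index)
  finally show "(J_mat n * J_mat n) $$ (i, j) = (- 1\<^sub>m (2 * n)) $$ (i, j)" .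
qed auto

definition sform :: "nat \<Rightarrow> real vec \<Rightarrow> real vec \<Rightarrow> real" where
  "sform n v w = v \<bullet> (J_mat n *\<^sub>v w)"

lemma J_mat_mult_vec [simp]: "v \<in> carrier_vec (2 * n) \<Longrightarrow> J_mat n *\<^sub>v v \<in> carrier_vec (2 * n)"
  using J_mat_carrier mult_mat_vec_carrier by blast

lemma J_mat_J_mat_vec:
  assumes "v \<in> carrier_vec (2 * n)"
  shows "J_mat n *\<^sub>v (J_mat n *\<^sub>v v) = - v"
proof -
  have "J_mat n *\<^sub>v (J_mat n *\<^sub>v v) = (J_mat n * J_mat n) *\<^sub>v v"
    using assms by (intro assoc_mult_mat_vec[symmetric]) auto
  then show ?thesis using assms by (simp add: J_mat_sq)
qed

lemma J_mat_vec_scalar_prod: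
  assumes "u \<in> carrier_vec (2 * n)" "v \<in> carrier_vec (2 * n)"
  shows "(J_mat n *\<^sub>v u) \<bullet> v = - sform n u v"
  using mult_mat_vec_adjoint[OF J_mat_carrier assms] assms
  by (simp add: J_mat_transpose sform_def)

lemma sform_skew:
  assumes "u \<in> carrier_vec (2 * n)" "v \<in> carrier_vec (2 * n)"
  shows "sform n u v = - sform n v u"
  using J_mat_vec_scalar_prod[of v n u] comm_scalar_prod[of u "2 * n" "J_mat n *\<^sub>v v"] assms
  by (simp add: sform_def[of n u v])

lemma sform_self: "u \<in> carrier_vec (2 * n) \<Longrightarrow> sform n u u = 0"
  using sform_skew[of u n u] by simp

lemma sform_add_right:
  assumes "u \<in> carrier_vec (2 * n)" "v \<in> carrier_vec (2 * n)" "w \<in> carrier_vec (2 * n)"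
  shows "sform n u (v + w) = sform n u v + sform n u w"
  using assms unfolding sform_def
  by (simp add: mult_add_distrib_mat_vec[OF J_mat_carrier] scalar_prod_add_distrib[of _ "2 * n"])

lemma sform_smult:
  assumes "u \<in> carrier_vec (2 * n)" "v \<in> carrier_vec (2 * n)"
  shows "sform n u (c \<cdot>\<^sub>v v) = c * sform n u v" "sform n (c \<cdot>\<^sub>v u) v = c * sform n u v"
  using assms unfolding sform_def
  by (simp_all add: mult_mat_vec[OF J_mat_carrier])

section \<open>Symplectic eigenpairs, split off one at a time\<close>

definition symplectic_eigensystem ::
  "nat \<Rightarrow> real mat \<Rightarrow> nat \<Rightarrow> (nat \<Rightarrow> real vec) \<Rightarrow> (nat \<Rightarrow> real vec) \<Rightarrow> (nat \<Rightarrow> real) \<Rightarrow> bool" where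
  "symplectic_eigensystem n M k x y l \<longleftrightarrow>
     (\<forall>i<k. x i \<in> carrier_vec (2 * n) \<and> y i \<in> carrier_vec (2 * n) \<and> 0 < l i \<and>
        M *\<^sub>v x i = l i \<cdot>\<^sub>v (J_mat n *\<^sub>v y i) \<and> M *\<^sub>v y i = - l i \<cdot>\<^sub>v (J_mat n *\<^sub>v x i)) \<and>
     (\<forall>i<k. \<forall>j<k. sform n (x i) (x j) = 0 \<and> sform n (y i) (y j) = 0 \<and>
        sform n (x i) (y j) = (if i = j then 1 else 0))"

text \<open>The eigenvector equation for \<open>J\<inverse>M\<close> with eigenvalue \<open>a + b\<i>\<close>, split into real and imaginary
  parts: symmetry of \<open>M\<close> and skewness of the form force \<open>a = 0\<close>, and positivity makes
  \<open>sform n x y\<close> nonzero of sign opposite to \<open>b\<close>.\<close>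

lemma normalized_eigenpair:
  assumes M: "sym_pos_def (2 * n) M"
    and x: "x \<in> carrier_vec (2 * n)" and y: "y \<in> carrier_vec (2 * n)"
    and nz: "x \<noteq> 0\<^sub>v (2 * n) \<or> y \<noteq> 0\<^sub>v (2 * n)"
    and Mx: "M *\<^sub>v x = a \<cdot>\<^sub>v (J_mat n *\<^sub>v x) + - b \<cdot>\<^sub>v (J_mat n *\<^sub>v y)"
    and My: "M *\<^sub>v y = b \<cdot>\<^sub>v (J_mat n *\<^sub>v x) + a \<cdot>\<^sub>v (J_mat n *\<^sub>v y)"
  obtains c u v where "u \<in> {c \<cdot>\<^sub>v x, c \<cdot>\<^sub>v y}" "v \<in> {c \<cdot>\<^sub>v x, c \<cdot>\<^sub>v y}"
    "sform n u v = 1" "0 < \<bar>b\<bar>"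
    "M *\<^sub>v u = \<bar>b\<bar> \<cdot>\<^sub>v (J_mat n *\<^sub>v v)" "M *\<^sub>v v = - \<bar>b\<bar> \<cdot>\<^sub>v (J_mat n *\<^sub>v u)"
proof -
  have Mc: "M \<in> carrier_mat (2 * n) (2 * n)" and MT: "M\<^sup>T = M"
    using M by (auto simp: sym_pos_def_def)
  let ?s = "sform n x y"
  have yx: "sform n y x = - ?s" using sform_skew[OF y x] .
  have J: "J_mat n *\<^sub>v x \<in> carrier_vec (2 * n)" "J_mat n *\<^sub>v y \<in> carrier_vec (2 * n)"
    using x y by auto
  have xMx: "x \<bullet> (M *\<^sub>v x) = - b * ?s" and yMy: "y \<bullet> (M *\<^sub>v y) = - b * ?s"
    and xMy: "x \<bullet> (M *\<^sub>v y) = a * ?s" and yMx: "y \<bullet> (M *\<^sub>v x) = - a * ?s"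
    unfolding Mx My using x y J yx sform_self[OF x] sform_self[OF y]
    by (simp_all add: scalar_prod_add_distrib[of _ "2 * n"] sform_def[symmetric])
  have pos: "0 \<le> v \<bullet> (M *\<^sub>v v)" "v \<noteq> 0\<^sub>v (2 * n) \<Longrightarrow> 0 < v \<bullet> (M *\<^sub>v v)"
    if "v \<in> carrier_vec (2 * n)" for v
    using M that Mc by (cases "v = 0\<^sub>v (2 * n)"; auto simp: sym_pos_def_def less_imp_le)+
  have bs: "b * ?s < 0" using nz pos[OF x] pos[OF y] xMx yMy by auto
  have "x \<bullet> (M *\<^sub>v y) = y \<bullet> (M *\<^sub>v x)"
    using mult_mat_vec_adjoint[OF Mc x y] MT comm_scalar_prod[of y "2 * n" "M *\<^sub>v x"] Mc x y
    by auto
  with xMy yMx bs have a: "a = 0" by auto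
  \<comment> \<open>Scaling both vectors by \<open>c\<close> turns the form value into 1 or
    -1.\<close>
  define c where "c = 1 / sqrt \<bar>?s\<bar>"
  have s0: "?s \<noteq> 0" and b0: "b \<noteq> 0" using bs by auto
  then have c: "c * c * \<bar>?s\<bar> = 1" by (simp add: c_def)
  have Mc': "M *\<^sub>v (c \<cdot>\<^sub>v v) = c \<cdot>\<^sub>v (M *\<^sub>v v)" if "v \<in> carrier_vec (2 * n)" for v
    using mult_mat_vec[OF Mc that] .
  have Jc: "J_mat n *\<^sub>v (c \<cdot>\<^sub>v v) = c \<cdot>\<^sub>v (J_mat n *\<^sub>v v)" if "v \<in> carrier_vec (2 * n)" for v
    using mult_mat_vec[OF J_mat_carrier that] .
  have Mx0: "M *\<^sub>v x = - b \<cdot>\<^sub>v (J_mat n *\<^sub>v y)" and My0: "M *\<^sub>v y = b \<cdot>\<^sub>v (J_mat n *\<^sub>v x)"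
    unfolding Mx My a using x y by (auto intro!: eq_vecI)
  \<comment> \<open>The sign of \<open>b\<close> decides which vector comes first: since
    \<open>b\<close> and \<open>sform n x y\<close> have opposite signs, the order with form value 1
    is also the one in which the equations carry \<bar>b\<bar>.\<close>
  show thesis
  proof (cases "b < 0")
    case True
    with bs have "?s > 0" by (simp add: mult_less_0_iff)
    show thesis
      by (rule that[of "c \<cdot>\<^sub>v x" c "c \<cdot>\<^sub>v y"])
        (use True \<open>?s > 0\<close> b0 c x y in \<open>auto
          simp: sform_smult Mc' Jc Mx0 My0 smult_smult_assoc mult.commute\<close>)
  next
    case False
    with b0 bs have "b > 0" "?s < 0" by (auto simp: mult_less_0_iff)
    show thesis
      by (rule that[of "c \<cdot>\<^sub>v y" c "c \<cdot>\<^sub>v x"])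
        (use \<open>b > 0\<close> \<open>?s < 0\<close> b0 c x y yx in \<open>auto
          simp: sform_smult Mc' Jc Mx0 My0 smult_smult_assoc mult.commute\<close>)
  qed
qed

text \<open>The symplectic complement \<open>C\<close> of the pairs found so far is invariant under
  \<open>A\<close>, which is the inverse of J times \<open>M\<close>: \<open>sform_A\<close> moves
  \<open>M\<close> onto \<open>x i\<close> and \<open>y i\<close>, where it yields multiples of J
  applied to the partner, and vectors of \<open>C\<close> are orthogonal to these. An eigenpair
  inside \<open>C\<close>, once normalized, is the new pair.\<close>

lemma symplectic_eigensystem_extend:
  assumes M: "sym_pos_def (2 * n) M" and sys: "symplectic_eigensystem n M k x y l" and "k < n"
  shows "\<exists>u v c. symplectic_eigensystem n M (Suc k) (x(k := u)) (y(k := v)) (l(k := c))"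
proof -
  have Mc: "M \<in> carrier_mat (2 * n) (2 * n)" and MT: "M\<^sup>T = M"
    using M by (auto simp: sym_pos_def_def)
  have xy: "x i \<in> carrier_vec (2 * n)" "y i \<in> carrier_vec (2 * n)"
    "M *\<^sub>v x i = l i \<cdot>\<^sub>v (J_mat n *\<^sub>v y i)" "M *\<^sub>v y i = - l i \<cdot>\<^sub>v (J_mat n *\<^sub>v x i)"
    if "i < k" for i
    using sys that unfolding symplectic_eigensystem_def by auto
  define C where "C = {w \<in> carrier_vec (2 * n). \<forall>i<k. sform n (x i) w = 0 \<and> sform n (y i) w = 0}"
  define A where "A = - J_mat n * M"
  have A: "A \<in> carrier_mat (2 * n) (2 * n)"
    unfolding A_def using Mc by (intro mult_carrier_mat[of _ _ "2 * n"]) auto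
  have Av: "A *\<^sub>v v = - (J_mat n *\<^sub>v (M *\<^sub>v v))" if "v \<in> carrier_vec (2 * n)" for v
  proof -
    have "A *\<^sub>v v = - J_mat n *\<^sub>v (M *\<^sub>v v)"
      unfolding A_def using Mc that by (intro assoc_mult_mat_vec) auto
    then show ?thesis using Mc that by simp
  qed
  have JAv: "J_mat n *\<^sub>v (A *\<^sub>v v) = M *\<^sub>v v" if "v \<in> carrier_vec (2 * n)" for v
  proof -
    have Mv: "M *\<^sub>v v \<in> carrier_vec (2 * n)" using Mc that by simp
    have "J_mat n *\<^sub>v (- (J_mat n *\<^sub>v (M *\<^sub>v v))) = - (J_mat n *\<^sub>v (J_mat n *\<^sub>v (M *\<^sub>v v)))"
      using Mv by (intro eq_vecI) auto
    then show ?thesis using J_mat_J_mat_vec[OF Mv] Mv Av[OF that] by simp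
  qed
  have sform_A: "sform n u (A *\<^sub>v v) = (M *\<^sub>v u) \<bullet> v"
    if "u \<in> carrier_vec (2 * n)" "v \<in> carrier_vec (2 * n)" for u v
    unfolding sform_def JAv[OF that(2)] using mult_mat_vec_adjoint[OF Mc that] MT by simp
  have inv: "A *\<^sub>v v \<in> C" if "v \<in> C" for v
  proof -
    have v: "v \<in> carrier_vec (2 * n)" using that by (simp add: C_def)
    have "sform n (x i) (A *\<^sub>v v) = 0 \<and> sform n (y i) (A *\<^sub>v v) = 0" if "i < k" for i
      using \<open>v \<in> C\<close> that xy[OF that] v by (simp add: sform_A J_mat_vec_scalar_prod C_def)
    then show ?thesis using A v by (simp add: C_def)
  qed
  have add: "u + v \<in> C" if "u \<in> C" "v \<in> C" for u v
    using that xy by (simp add: C_def sform_add_right)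
  have smult: "c \<cdot>\<^sub>v v \<in> C" if "v \<in> C" for c v
    using that xy by (simp add: C_def sform_smult)
  \<comment> \<open>Membership in \<open>C\<close> amounts to 2k linear equations in 2n unknowns,
    and k < n leaves a nonzero solution.\<close>
  obtain w where w: "w \<in> C" "w \<noteq> 0\<^sub>v (2 * n)"
  proof -
    define K where "K = mat_of_rows (2 * n)
      (map (\<lambda>i. J_mat n *\<^sub>v x i) [0..<k] @ map (\<lambda>i. J_mat n *\<^sub>v y i) [0..<k])"
    have K: "K \<in> carrier_mat (2 * k) (2 * n)" by (simp add: K_def mat_of_rows_def mult_2)
    then obtain w where w: "w \<in> carrier_vec (2 * n)" "w \<noteq> 0\<^sub>v (2 * n)" "K *\<^sub>v w = 0\<^sub>v (2 * k)"
      using ex_kernel_vec[OF K] \<open>k < n\<close> by auto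
    have "sform n (x i) w = 0" "sform n (y i) w = 0" if i: "i < k" for i
    proof -
      have "row K i = J_mat n *\<^sub>v x i" "row K (k + i) = J_mat n *\<^sub>v y i"
        using i xy by (auto simp: K_def nth_append)
      then have "(K *\<^sub>v w) $ i = - sform n (x i) w" "(K *\<^sub>v w) $ (k + i) = - sform n (y i) w"
        using i K w(1) xy by (simp_all add: J_mat_vec_scalar_prod)
      with w(3) i show "sform n (x i) w = 0" "sform n (y i) w = 0" by auto
    qed
    with w show thesis by (intro that[of w]) (auto simp: C_def)
  qed
  obtain p q a b where pq: "p \<in> C" "q \<in> C" "p \<noteq> 0\<^sub>v (2 * n) \<or> q \<noteq> 0\<^sub>v (2 * n)"
    "A *\<^sub>v p = a \<cdot>\<^sub>v p - b \<cdot>\<^sub>v q" "A *\<^sub>v q = b \<cdot>\<^sub>v p + a \<cdot>\<^sub>v q"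
    using invariant_subspace_eigenpair[OF A _ add smult inv w] unfolding C_def by blast
  have pqc: "p \<in> carrier_vec (2 * n)" "q \<in> carrier_vec (2 * n)" using pq by (auto simp: C_def)
  have "M *\<^sub>v p = a \<cdot>\<^sub>v (J_mat n *\<^sub>v p) + - b \<cdot>\<^sub>v (J_mat n *\<^sub>v q)"
  proof -
    have "a \<cdot>\<^sub>v p - b \<cdot>\<^sub>v q = a \<cdot>\<^sub>v p + - b \<cdot>\<^sub>v q" using pqc by (intro eq_vecI) auto
    with JAv[OF pqc(1)] pq(4) show ?thesis
      using pqc by (simp add: mult_add_distrib_mat_vec[OF J_mat_carrier] mult_mat_vec[OF J_mat_carrier])
  qed
  moreover have "M *\<^sub>v q = b \<cdot>\<^sub>v (J_mat n *\<^sub>v p) + a \<cdot>\<^sub>v (J_mat n *\<^sub>v q)"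
    using JAv[OF pqc(2)] pq(5) pqc
    by (simp add: mult_add_distrib_mat_vec[OF J_mat_carrier] mult_mat_vec[OF J_mat_carrier])
  ultimately obtain c u v where uv: "u \<in> {c \<cdot>\<^sub>v p, c \<cdot>\<^sub>v q}" "v \<in> {c \<cdot>\<^sub>v p, c \<cdot>\<^sub>v q}"
    "sform n u v = 1" "0 < \<bar>b\<bar>"
    "M *\<^sub>v u = \<bar>b\<bar> \<cdot>\<^sub>v (J_mat n *\<^sub>v v)" "M *\<^sub>v v = - \<bar>b\<bar> \<cdot>\<^sub>v (J_mat n *\<^sub>v u)"
    using normalized_eigenpair[OF M pqc pq(3)] by metis
  have uvC: "u \<in> C" "v \<in> C" using uv(1,2) pq smult by auto
  then have uvc: "u \<in> carrier_vec (2 * n)" "v \<in> carrier_vec (2 * n)" by (auto simp: C_def)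
  have orth: "sform n (x i) u = 0" "sform n (y i) u = 0" "sform n (x i) v = 0" "sform n (y i) v = 0"
    "sform n u (x i) = 0" "sform n u (y i) = 0" "sform n v (x i) = 0" "sform n v (y i) = 0"
    if "i < k" for i
    using uvC that sform_skew[of u n "x i"] sform_skew[of u n "y i"] sform_skew[of v n "x i"]
      sform_skew[of v n "y i"] xy[OF that] uvc by (auto simp: C_def)
  have "symplectic_eigensystem n M (Suc k) (x(k := u)) (y(k := v)) (l(k := \<bar>b\<bar>))"
    using sys uv(3-6) uvc orth sform_self[OF uvc(1)] sform_self[OF uvc(2)]
    unfolding symplectic_eigensystem_def by (auto simp: less_Suc_eq)
  then show ?thesis by blast
qed

lemma ex_symplectic_eigensystem:
  assumes "sym_pos_def (2 * n) M" "k \<le> n"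
  shows "\<exists>x y l. symplectic_eigensystem n M k x y l"
  using assms(2)
proof (induction k)
  case 0
  show ?case by (simp add: symplectic_eigensystem_def)
next
  case (Suc k)
  then show ?case using symplectic_eigensystem_extend[OF assms(1)] by (metis Suc_le_lessD Suc_leD)
qed

text \<open>The eigenpairs are found in no particular order, whereas
  \<open>symplectic_eigenvalues\<close> asks for increasing values.\<close>

lemma ex_sorting_bij:
  fixes l :: "nat \<Rightarrow> 'a :: linorder"
  obtains p where "bij_betw p {..<n} {..<n}" "mono_on {..<n} (l \<circ> p)"
proof -
  define ps where "ps = sort_key l [0..<n]"
  have len: "length ps = n" and "distinct ps" and "set ps = {..<n}" by (auto simp: ps_def)
  then have bij: "bij_betw (nth ps) {..<n} {..<n}" using bij_betw_nth by blast
  have "sorted (map l ps)" by (simp add: ps_def)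
  then have "mono_on {..<n} (l \<circ> nth ps)"
    using len by (auto simp: mono_on_def sorted_iff_nth_mono)
  with bij that show thesis by blast
qed

text \<open>Writing the block matrix as a single \<open>mat_diag\<close> makes multiplication by it
  a scaling of rows or columns.\<close>

definition double_diag :: "nat \<Rightarrow> (nat \<Rightarrow> real) \<Rightarrow> real mat" where
  "double_diag n d = mat_diag (2 * n) (\<lambda>i. if i < n then d i else d (i - n))"

lemma four_block_mat_diag_eq_double_diag:
  "four_block_mat (mat_diag n d) (0\<^sub>m n n) (0\<^sub>m n n) (mat_diag n d) = double_diag n d"
  by (rule eq_matI) (auto simp: double_diag_def mat_diag_def)

lemma double_diag_dim [simp]: "dim_row (double_diag n d) = 2 * n" "dim_col (double_diag n d) = 2 * n"
  by (simp_all add: double_diag_def mat_diag_def)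

text \<open>A full system of n pairs, sorted by value, provides the columns of \<open>S\<close>: all
  \<open>x i\<close> first, then all \<open>y i\<close>. By \<open>index_gram\<close>, both matrix
  identities reduce to form values of the pairs.\<close>

lemma williamson:
  assumes M: "sym_pos_def (2 * n) M"
  obtains d where "symplectic_eigenvalues n M d"
proof -
  have Mc: "M \<in> carrier_mat (2 * n) (2 * n)" using M by (auto simp: sym_pos_def_def)
  obtain x0 y0 l0 where sys0: "symplectic_eigensystem n M n x0 y0 l0"
    using ex_symplectic_eigensystem[OF M] by blast
  obtain p where p: "bij_betw p {..<n} {..<n}" and mono: "mono_on {..<n} (l0 \<circ> p)"
    using ex_sorting_bij by blast
  define x y l where "x = x0 \<circ> p" and "y = y0 \<circ> p" and "l = l0 \<circ> p"
  have pn: "p i < n" if "i < n" for i using p that by (auto simp: bij_betw_def)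
  have pinj: "p i = p j \<longleftrightarrow> i = j" if "i < n" "j < n" for i j
    using p that by (auto simp: bij_betw_def inj_on_def)
  have sys: "symplectic_eigensystem n M n x y l"
    using sys0 pn pinj unfolding symplectic_eigensystem_def x_def y_def l_def by auto
  have vec: "x i \<in> carrier_vec (2 * n)" "y i \<in> carrier_vec (2 * n)" "0 < l i"
      "M *\<^sub>v x i = l i \<cdot>\<^sub>v (J_mat n *\<^sub>v y i)" "M *\<^sub>v y i = - l i \<cdot>\<^sub>v (J_mat n *\<^sub>v x i)"
    if "i < n" for i
    using sys that unfolding symplectic_eigensystem_def by auto
  have sf: "sform n (x i) (x j) = 0" "sform n (y i) (y j) = 0"
      "sform n (x i) (y j) = (if i = j then 1 else 0)"
    if "i < n" "j < n" for i j
    using sys that unfolding symplectic_eigensystem_def by auto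
  have sf': "sform n (y i) (x j) = (if i = j then - 1 else 0)" if "i < n" "j < n" for i j
    using sform_skew[of "y i" n "x j"] vec that sf by auto
  define S where "S = mat_of_cols (2 * n) (map x [0..<n] @ map y [0..<n])"
  have S: "S \<in> carrier_mat (2 * n) (2 * n)" by (simp add: S_def mat_of_cols_def mult_2)
  have colS: "col S i = (if i < n then x i else y (i - n))" if "i < 2 * n" for i
    using that vec by (auto simp: S_def nth_append)
  have "S\<^sup>T * J_mat n * S = J_mat n"
  proof (rule eq_matI)
    fix i j assume "i < dim_row (J_mat n)" "j < dim_col (J_mat n)"
    then have ij: "i < 2 * n" "j < 2 * n" by auto
    show "(S\<^sup>T * J_mat n * S) $$ (i, j) = J_mat n $$ (i, j)"
      unfolding index_gram[OF J_mat_carrier S ij] sform_def[symmetric]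
      using ij by (auto simp: colS sf sf' J_mat_index)
  qed (use S in auto)
  with S have "S \<in> Sp n n" by (simp add: Sp_def)
  moreover have "S\<^sup>T * M * S = double_diag n l"
  proof (rule eq_matI)
    fix i j assume "i < dim_row (double_diag n l)" "j < dim_col (double_diag n l)"
    then have ij: "i < 2 * n" "j < 2 * n" by auto
    \<comment> \<open>The minus sign in the equation for \<open>y i\<close> cancels against the
      value -1 of \<open>sform n (y i) (x i)\<close>, so both diagonal blocks carry the same
      positive values.\<close>
    show "(S\<^sup>T * M * S) $$ (i, j) = double_diag n l $$ (i, j)"
      unfolding index_gram[OF Mc S ij]
      using ij by (auto simp: colS vec sform_def[symmetric] sf sf' double_diag_def mat_diag_def)
  qed (use S in auto)
  ultimately have "symplectic_eigenvalues n M l"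
    unfolding symplectic_eigenvalues_def four_block_mat_diag_eq_double_diag
    using vec mono by (auto simp: l_def)
  then show thesis using that by blast
qed

section \<open>Critical points\<close>

lemma assoc_mult_mat_dim:
  fixes A B C :: "real mat"
  assumes "dim_col A = dim_row B" "dim_col B = dim_row C"
  shows "A * B * C = A * (B * C)"
  using assms by (intro assoc_mult_mat[of _ "dim_row A" "dim_col A" _ "dim_col B" _ "dim_col C"]) auto

lemma transpose_mult_dim:
  fixes A B :: "real mat"
  assumes "dim_col A = dim_row B"
  shows "(A * B)\<^sup>T = B\<^sup>T * A\<^sup>T"
  using assms by (intro transpose_mult[of _ "dim_row A" "dim_col A" _ "dim_col B"]) auto

lemma one_mult_dim: "dim_row A = m \<Longrightarrow> 1\<^sub>m m * A = A" "dim_col A = m \<Longrightarrow> A * 1\<^sub>m m = A"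
  for A :: "real mat"
  by (auto intro: left_mult_one_mat' right_mult_one_mat')

lemma J_mat_J_mat_mult:
  assumes "dim_row A = 2 * n"
  shows "J_mat n * (J_mat n * A) = - A"
proof -
  have "J_mat n * (J_mat n * A) = J_mat n * J_mat n * A"
    using assms by (simp add: assoc_mult_mat_dim)
  then show ?thesis using assms by (simp add: J_mat_sq one_mult_dim)
qed

text \<open>Normal form for matrix expressions: products nested to the right, transposes pushed to
  the factors, adjacent copies of J cancelled. The side conditions are equations between dimensions,
  which simp can check.\<close>

lemmas mat_dim_simps = assoc_mult_mat_dim transpose_mult_dim one_mult_dim J_mat_J_mat_mult J_mat_sq
  J_mat_transpose

lemma SpD:
  assumes "X \<in> Sp k n"
  shows "dim_row X = 2 * n" "dim_col X = 2 * k" "X\<^sup>T * (J_mat n * X) = J_mat k"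
  using assms by (auto simp: Sp_def mat_dim_simps)

lemma SpI:
  assumes "dim_row X = 2 * n" "dim_col X = 2 * k" "X\<^sup>T * (J_mat n * X) = J_mat k"
  shows "X \<in> Sp k n"
  using assms by (auto simp: Sp_def mat_dim_simps)

text \<open>The defining relation in the shape it takes inside a right-nested product.\<close>

lemma Sp_mult_left:
  assumes "X \<in> Sp k n" "dim_row A = 2 * k"
  shows "X\<^sup>T * (J_mat n * (X * A)) = J_mat k * A"
proof -
  have "X\<^sup>T * (J_mat n * (X * A)) = X\<^sup>T * (J_mat n * X) * A"
    using assms SpD(1,2)[OF assms(1)] by (simp add: mat_dim_simps)
  then show ?thesis using SpD(3)[OF assms(1)] by simp
qed

lemma Sp_mult:
  assumes X: "X \<in> Sp k n" and Y: "Y \<in> Sp m k"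
  shows "X * Y \<in> Sp m n"
  using SpD[OF X] SpD[OF Y] Sp_mult_left[OF X, of Y] by (intro SpI) (auto simp: mat_dim_simps)

text \<open>The defining relation makes \<open>- (J_mat n * (S\<^sup>T * J_mat n))\<close> a left
  inverse of \<open>S\<close>. For square matrices it is a right inverse as well, and multiplying by
  J on the right gives the claim.\<close>

lemma Sp_transpose:
  assumes S: "S \<in> Sp n n"
  shows "S * (J_mat n * S\<^sup>T) = J_mat n"
proof -
  note d = SpD[OF S]
  have "- (J_mat n * (S\<^sup>T * J_mat n)) * S = 1\<^sub>m (2 * n)"
    using d by (simp add: mat_dim_simps)
  then have *: "S * - (J_mat n * (S\<^sup>T * J_mat n)) = 1\<^sub>m (2 * n)"
    by (rule mat_mult_left_right_inverse[rotated 2]) (use d(1,2) in auto)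
  have "S * (J_mat n * S\<^sup>T) = S * - (J_mat n * (S\<^sup>T * J_mat n)) * J_mat n"
    using d(1,2) by (simp add: mat_dim_simps)
  also have "\<dots> = J_mat n" unfolding * by (simp add: one_mult_dim)
  finally show ?thesis .
qed

lemma Sp_transpose_mult:
  assumes S: "S \<in> Sp n n" and "dim_row A = 2 * n"
  shows "S * (J_mat n * (S\<^sup>T * A)) = J_mat n * A"
proof -
  have "S * (J_mat n * (S\<^sup>T * A)) = S * (J_mat n * S\<^sup>T) * A"
    using assms SpD(1,2)[OF S] by (simp add: mat_dim_simps)
  then show ?thesis using Sp_transpose[OF S] by simp
qed

lemma OrSp_transpose:
  assumes K: "K \<in> OrSp k"
  shows "K * K\<^sup>T = 1\<^sub>m (2 * k)" "K\<^sup>T \<in> OrSp k"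
proof -
  have KS: "K \<in> Sp k k" and KK: "K\<^sup>T * K = 1\<^sub>m (2 * k)" using K by (auto simp: OrSp_def)
  note d = SpD[OF KS]
  show 1: "K * K\<^sup>T = 1\<^sub>m (2 * k)"
    by (rule mat_mult_left_right_inverse[OF _ _ KK]) (use d(1,2) in auto)
  with d show "K\<^sup>T \<in> OrSp k"
    unfolding OrSp_def by (auto intro!: SpI simp: Sp_transpose[OF KS])
qed

section \<open>Critical points and orthogonal symplectic changes of basis\<close>

lemma critical_point_iff:
  "critical_point k n M X \<longleftrightarrow> X \<in> Sp k n \<and>
     (\<exists>L \<in> carrier_mat (2 * k) (2 * k). L\<^sup>T = - L \<and> M * X = J_mat n * X * L)"
proof -
  have "constraint k n X = 0\<^sub>m (2 * k) (2 * k) \<longleftrightarrow> X\<^sup>T * J_mat n * X = J_mat k"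
    if X: "X \<in> carrier_mat (2 * n) (2 * k)"
  proof
    assume *: "constraint k n X = 0\<^sub>m (2 * k) (2 * k)"
    show "X\<^sup>T * J_mat n * X = J_mat k"
    proof (rule eq_matI)
      fix i j assume ij: "i < dim_row (J_mat k)" "j < dim_col (J_mat k)"
      then have "(X\<^sup>T * J_mat n * X - J_mat k) $$ (i, j) =
          (X\<^sup>T * J_mat n * X) $$ (i, j) - J_mat k $$ (i, j)"
        by (intro index_minus_mat)
      then show "(X\<^sup>T * J_mat n * X) $$ (i, j) = J_mat k $$ (i, j)"
        using * ij by (simp add: constraint_def del: index_mult_mat)
    qed (use X in auto)
  qed (simp add: constraint_def)
  then show ?thesis unfolding critical_point_def Sp_def by auto
qed

text \<open>Inserting \<open>K * K\<^sup>T\<close> between \<open>X\<close> and \<open>L\<close>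
  shows that \<open>K\<^sup>T * (L * K)\<close> is a multiplier for \<open>X * K\<close>. It
  inherits skewness from \<open>L\<close>, and symplecticity of \<open>K\<close> preserves the
  constraint.\<close>

lemma critical_point_mult_OrSp:
  assumes M: "M \<in> carrier_mat (2 * n) (2 * n)"
    and X: "critical_point k n M X" and K: "K \<in> OrSp k"
  shows "critical_point k n M (X * K)"
proof -
  have KS: "K \<in> Sp k k" using K by (auto simp: OrSp_def)
  obtain L where XS: "X \<in> Sp k n" and L: "L \<in> carrier_mat (2 * k) (2 * k)" "L\<^sup>T = - L"
    "M * X = J_mat n * X * L"
    using X by (auto simp: critical_point_iff)
  note d = SpD(1,2)[OF KS] SpD(1,2)[OF XS] carrier_matD[OF M] carrier_matD[OF L(1)]
  let ?L = "K\<^sup>T * (L * K)"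
  have "?L\<^sup>T = - ?L" using d L(2) by (simp add: mat_dim_simps)
  moreover have "M * (X * K) = J_mat n * (X * K) * ?L"
  proof -
    have "M * (X * K) = M * X * K" using d by (simp add: mat_dim_simps)
    also have "\<dots> = J_mat n * (X * (1\<^sub>m (2 * k) * (L * K)))"
      unfolding L(3) using d by (simp add: mat_dim_simps)
    also have "\<dots> = J_mat n * (X * K) * ?L"
      unfolding OrSp_transpose(1)[OF K, symmetric] using d by (simp add: mat_dim_simps)
    finally show ?thesis .
  qed
  moreover have "?L \<in> carrier_mat (2 * k) (2 * k)" using d by auto
  ultimately show ?thesis using Sp_mult[OF XS KS] by (auto simp: critical_point_iff)
qed

section \<open>Diagonal forms and the multiplier of an eigenvector set\<close>

definition rotation_block :: "nat \<Rightarrow> (nat \<Rightarrow> real) \<Rightarrow> real mat" where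
  "rotation_block k l = four_block_mat (0\<^sub>m k k) (- mat_diag k l) (mat_diag k l) (0\<^sub>m k k)"

text \<open>Up to signs J swaps the two halves of the coordinates, and the diagonal is the same on
  both halves.\<close>

lemma double_diag_mult_J_mat: "double_diag n d * J_mat n = J_mat n * double_diag n d"
  unfolding double_diag_def mat_diag_mult_left[OF J_mat_carrier] mat_diag_mult_right[OF J_mat_carrier]
  by (rule eq_matI) (auto simp: J_mat_index)

lemma rotation_block_eq: "rotation_block n d = - (J_mat n * double_diag n d)"
  unfolding double_diag_def mat_diag_mult_right[OF J_mat_carrier] rotation_block_def
  by (rule eq_matI) (auto simp: J_mat_index mat_diag_def)

lemma double_diag_transpose: "(double_diag n d)\<^sup>T = double_diag n d"
  by (rule eq_matI) (auto simp: double_diag_def mat_diag_def)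

lemma rotation_block_dim [simp]:
  "dim_row (rotation_block n d) = 2 * n" "dim_col (rotation_block n d) = 2 * n"
  by (simp_all add: rotation_block_eq)

lemma rotation_block_transpose: "(rotation_block n d)\<^sup>T = - rotation_block n d"
  unfolding rotation_block_eq transpose_uminus
  by (simp add: mat_dim_simps double_diag_transpose double_diag_mult_J_mat)

text \<open>Multiplying the diagonal form by \<open>S\<close> and J from the left,
  \<open>Sp_transpose_mult\<close> absorbs \<open>S\<^sup>T\<close> and leaves J W S on one side.
  One more factor J isolates \<open>W * S\<close>, and \<open>rotation_block_eq\<close> supplies the
  block.\<close>

lemma Sp_diagonalization_imp_eigen_eq:
  assumes S: "S \<in> Sp n n" and W: "W \<in> carrier_mat (2 * n) (2 * n)"
    and D: "S\<^sup>T * W * S = double_diag n d"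
  shows "W * S = J_mat n * (S * rotation_block n d)"
proof -
  note dim = SpD(1,2)[OF S] carrier_matD[OF W]
  have "J_mat n * (W * S) = S * (J_mat n * (S\<^sup>T * (W * S)))"
    using Sp_transpose_mult[OF S, of "W * S"] dim by simp
  also have "\<dots> = S * (J_mat n * double_diag n d)" using D dim by (simp add: mat_dim_simps)
  finally have "J_mat n * (J_mat n * (W * S)) = J_mat n * (S * (J_mat n * double_diag n d))"
    by simp
  then have "- (W * S) = J_mat n * (S * (J_mat n * double_diag n d))"
    using dim by (simp add: mat_dim_simps)
  then have "W * S = - (J_mat n * (S * (J_mat n * double_diag n d)))"
    by (metis uminus_uminus_mat)
  then show ?thesis using dim by (simp add: rotation_block_eq mat_dim_simps)
qed

text \<open>\<open>Q = S + J S J\<close> satisfies \<open>W Q = - Q (D \<oplus> D)\<close>; since \<open>W\<close> is positive definite and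
  \<open>D\<close> is positive, \<open>Q = 0\<close>. So \<open>S\<close> commutes with \<open>J\<close>, and a symplectic matrix
  commuting with \<open>J\<close> is orthogonal.\<close>

lemma Sp_diagonalization_OrSp:
  assumes W: "sym_pos_def (2 * n) W" and comm: "J_mat n * W = W * J_mat n"
    and S: "S \<in> Sp n n" and D: "S\<^sup>T * W * S = double_diag n d" and pos: "\<forall>i<n. 0 < d i"
  shows "S \<in> OrSp n"
proof -
  have Wc: "W \<in> carrier_mat (2 * n) (2 * n)" using W by (simp add: sym_pos_def_def)
  note dim = SpD(1,2)[OF S] carrier_matD[OF Wc]
  define Q where "Q = S + J_mat n * (S * J_mat n)"
  have Q: "Q \<in> carrier_mat (2 * n) (2 * n)" using dim by (auto simp: Q_def)
  have WS: "W * S = - (J_mat n * (S * (J_mat n * double_diag n d)))"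
    using Sp_diagonalization_imp_eigen_eq[OF S Wc D] dim
    by (simp add: rotation_block_eq mat_dim_simps)
  have "W * (J_mat n * (S * J_mat n)) = W * J_mat n * (S * J_mat n)"
    using dim by (simp add: mat_dim_simps)
  also have "\<dots> = J_mat n * (W * S * J_mat n)"
    unfolding comm[symmetric] using dim by (simp add: mat_dim_simps)
  also have "\<dots> = - (S * double_diag n d)"
    unfolding WS using dim by (simp add: mat_dim_simps double_diag_mult_J_mat)
  finally have WJSJ: "W * (J_mat n * (S * J_mat n)) = - (S * double_diag n d)" .
  have "W * Q = W * S + W * (J_mat n * (S * J_mat n))"
    unfolding Q_def by (rule mult_add_distrib_mat[OF Wc, of _ "2 * n"]) (use dim in auto)
  also have "\<dots> = - (S * double_diag n d + J_mat n * (S * J_mat n) * double_diag n d)"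
    unfolding WS WJSJ using dim by (intro eq_matI) (auto simp: mat_dim_simps simp del: index_mult_mat(1))
  also have "\<dots> = - (Q * double_diag n d)"
    unfolding Q_def
    by (subst add_mult_distrib_mat[of _ "2 * n" "2 * n" _ _ "2 * n"]) (use dim in auto)
  finally have WQ: "W * Q = - (Q * double_diag n d)" .
  \<comment> \<open>A nonzero column q of \<open>Q\<close> would satisfy W q = -c q with c > 0,
    which contradicts the positivity of \<open>W\<close>.\<close>
  have "col Q i = 0\<^sub>v (2 * n)" if i: "i < 2 * n" for i
  proof (rule ccontr)
    assume nz: "col Q i \<noteq> 0\<^sub>v (2 * n)"
    let ?q = "col Q i" and ?c = "if i < n then d i else d (i - n)"
    have q: "?q \<in> carrier_vec (2 * n)" using Q by (intro carrier_vecI) simp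
    have "W *\<^sub>v ?q = col (W * Q) i" using i Q dim by (intro eq_vecI) auto
    also have "\<dots> = - ?c \<cdot>\<^sub>v ?q"
      unfolding WQ double_diag_def mat_diag_mult_right[OF Q] using i Q by (intro eq_vecI) auto
    finally have "?q \<bullet> (W *\<^sub>v ?q) = - ?c * (?q \<bullet> ?q)" using q by simp
    moreover have "0 \<le> ?q \<bullet> ?q" by (simp add: scalar_prod_def sum_nonneg)
    moreover have "0 < ?c" using pos i by auto
    ultimately have "?q \<bullet> (W *\<^sub>v ?q) \<le> 0" by (simp add: mult_nonneg_nonneg)
    moreover have "0 < ?q \<bullet> (W *\<^sub>v ?q)" using W nz q by (auto simp: sym_pos_def_def)
    ultimately show False by simp
  qed
  then have Q0: "Q $$ (i, j) = 0" if "i < 2 * n" "j < 2 * n" for i j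
    using that Q by (metis carrier_matD index_col index_zero_vec(1))
  have JSJ: "J_mat n * (S * J_mat n) = - S"
  proof (rule eq_matI)
    fix i j assume ij: "i < dim_row (- S)" "j < dim_col (- S)"
    then have "Q $$ (i, j) = S $$ (i, j) + (J_mat n * (S * J_mat n)) $$ (i, j)"
      unfolding Q_def using dim by (intro index_add_mat) auto
    with Q0[of i j] ij dim show "(J_mat n * (S * J_mat n)) $$ (i, j) = (- S) $$ (i, j)" by simp
  qed (use dim in auto)
  then have "J_mat n * (J_mat n * (S * J_mat n)) = - (J_mat n * S)" using dim by simp
  then have "- (S * J_mat n) = - (J_mat n * S)" using dim by (simp add: mat_dim_simps)
  then have SJ: "S * J_mat n = J_mat n * S" by (metis uminus_uminus_mat)
  \<comment> \<open>With -1 written as the square of J, one factor J moves across \<open>S\<close>,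
    so that the symplectic relation applies.\<close>
  have "- (S\<^sup>T * S) = S\<^sup>T * (J_mat n * (J_mat n * S))" using dim by (simp add: mat_dim_simps)
  also have "\<dots> = - 1\<^sub>m (2 * n)"
    unfolding SJ[symmetric] using Sp_mult_left[OF S, of "J_mat n"] by (simp add: J_mat_sq)
  finally have "S\<^sup>T * S = 1\<^sub>m (2 * n)" by (metis uminus_uminus_mat)
  with S show ?thesis by (simp add: OrSp_def)
qed

text \<open>In Williamson coordinates the equation, applied twice, compares squares: each entry of
  column \<open>i\<close> of \<open>U\<close> vanishes unless the matching diagonal entry equals
  \<open>l i\<close>. If \<open>l i\<close> were no symplectic eigenvalue, column \<open>i\<close>
  of \<open>Y\<close> would be zero, although its form value with column \<open>i + k\<close> is
  1.\<close>

lemma symplectic_eigenvalueI: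
  assumes M: "sym_pos_def (2 * n) M" and Y: "Y \<in> Sp k n"
    and MY: "M * Y = J_mat n * (Y * rotation_block k l)" and i: "i < k" and pos: "0 < l i"
  shows "symplectic_eigenvalue n M (l i)"
proof (rule ccontr)
  assume not: "\<not> ?thesis"
  have Mc: "M \<in> carrier_mat (2 * n) (2 * n)" using M by (simp add: sym_pos_def_def)
  obtain d where d: "symplectic_eigenvalues n M d" using williamson[OF M] .
  then obtain S where S: "S \<in> Sp n n" and D: "S\<^sup>T * M * S = double_diag n d"
    unfolding symplectic_eigenvalues_def four_block_mat_diag_eq_double_diag by auto
  note dim = SpD(1,2)[OF S] SpD(1,2)[OF Y] carrier_matD[OF Mc]
  let ?D = "double_diag n d" and ?E = "double_diag k l" and ?N = "rotation_block k l"
  \<comment> \<open>This is the inverse of \<open>S\<close> times \<open>Y\<close>, that is, the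
    coordinates of the columns of \<open>Y\<close> in the Williamson basis.\<close>
  define U where "U = - (J_mat n * (S\<^sup>T * (J_mat n * Y)))"
  have U: "U \<in> carrier_mat (2 * n) (2 * k)" using dim by (auto simp: U_def)
  note dim = dim carrier_matD[OF U]
  have SU: "S * U = Y"
    unfolding U_def using dim Sp_transpose_mult[OF S, of "J_mat n * Y"] by (simp add: mat_dim_simps)
  have "?D * U = S\<^sup>T * (M * (S * U))" unfolding D[symmetric] using dim by (simp add: mat_dim_simps)
  also have "\<dots> = S\<^sup>T * (J_mat n * (S * (U * ?N)))"
    unfolding SU MY using dim SU[symmetric] by (simp add: mat_dim_simps)
  also have "\<dots> = J_mat n * (U * ?N)" using Sp_mult_left[OF S] dim by simp
  finally have DU: "?D * U = J_mat n * (U * ?N)" .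
  \<comment> \<open>Since \<open>?D\<close> commutes with J, the relation \<open>DU\<close> can be
    used a second time. The minus signs from the squares of J and of \<open>?N\<close>
    cancel.\<close>
  have "?D * (?D * U) = ?D * J_mat n * (U * ?N)" unfolding DU using dim by (simp add: mat_dim_simps)
  also have "\<dots> = J_mat n * (?D * U * ?N)"
    unfolding double_diag_mult_J_mat using dim by (simp add: mat_dim_simps)
  also have "\<dots> = - (U * (?N * ?N))" unfolding DU using dim by (simp add: mat_dim_simps)
  also have "?N * ?N = - (?E * ?E)"
  proof -
    have "?N * ?N = J_mat k * (?E * J_mat k * ?E)"
      unfolding rotation_block_eq by (simp add: mat_dim_simps)
    then show ?thesis unfolding double_diag_mult_J_mat by (simp add: mat_dim_simps)
  qed
  also have "- (U * - (?E * ?E)) = U * (?E * ?E)" using dim by simp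
  also have "?D * (?D * U) = ?D * ?D * U" using dim by (simp add: mat_dim_simps)
  finally have DDU: "?D * ?D * U = U * (?E * ?E)" .
  have U0: "U $$ (a, i) = 0" if a: "a < 2 * n" for a
  proof -
    let ?c = "if a < n then d a else d (a - n)"
    have "?c * ?c * U $$ (a, i) = (?D * ?D * U) $$ (a, i)"
      unfolding double_diag_def mat_diag_diag mat_diag_mult_left[OF U] using a i by auto
    also have "\<dots> = U $$ (a, i) * (l i * l i)"
      unfolding DDU unfolding double_diag_def mat_diag_diag mat_diag_mult_right[OF U] using a i by auto
    finally have "U $$ (a, i) = 0 \<or> ?c * ?c = l i * l i" by simp
    moreover have "?c > 0" using d a by (auto simp: symplectic_eigenvalues_def)
    moreover have "?c \<noteq> l i"
    proof -
      have "\<exists>j<n. ?c = d j"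
      proof (cases "a < n")
        case False
        then show ?thesis using a by (intro exI[of _ "a - n"]) auto
      qed auto
      with not d show ?thesis unfolding symplectic_eigenvalue_def by metis
    qed
    \<comment> \<open>Equal squares leave \<open>l i\<close> or its negative; positivity of both
      values excludes the latter.\<close>
    ultimately show ?thesis using pos by (auto simp: square_eq_iff)
  qed
  have "col U i = 0\<^sub>v (2 * n)" using U0 i U by (intro eq_vecI) simp_all
  moreover have Sc: "S \<in> carrier_mat (2 * n) (2 * n)" using dim by (intro carrier_matI)
  moreover have "col Y i = S *\<^sub>v col U i"
    unfolding SU[symmetric] using i by (intro col_mult2[OF Sc U]) simp
  ultimately have "col Y i = 0\<^sub>v (2 * n)" by (intro eq_vecI) simp_all
  then have "(Y\<^sup>T * J_mat n * Y) $$ (i, i + k) = 0"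
    using i dim by (subst index_gram[of _ "2 * n" _ "2 * k"])
      (auto intro!: scalar_prod_left_zero J_mat_mult_vec carrier_vecI)
  moreover have "Y\<^sup>T * J_mat n * Y = J_mat k" using Y by (simp add: Sp_def)
  ultimately show False using i by (simp add: J_mat_index)
qed

section \<open>Critical points versus normalized eigenvector sets\<close>

lemma critical_point_imp_eigenvector_set:
  assumes M: "sym_pos_def (2 * n) M" and X: "critical_point k n M X"
  shows "\<exists>K \<in> OrSp k. normalized_symplectic_eigenvector_set k n M (X * K)"
proof -
  have Mc: "M \<in> carrier_mat (2 * n) (2 * n)" and MT: "M\<^sup>T = M"
    using M by (auto simp: sym_pos_def_def)
  obtain L where XS: "X \<in> Sp k n" and L: "L \<in> carrier_mat (2 * k) (2 * k)" "L\<^sup>T = - L"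
    "M * X = J_mat n * X * L"
    using X by (auto simp: critical_point_iff)
  note dim = SpD(1,2)[OF XS] carrier_matD[OF Mc] carrier_matD[OF L(1)]
  define W where "W = X\<^sup>T * (M * X)"
  have Wc: "W \<in> carrier_mat (2 * k) (2 * k)"
    unfolding W_def using dim by (intro carrier_matI) simp_all
  have WL: "W = J_mat k * L"
    unfolding W_def L(3) using Sp_mult_left[OF XS, of L] dim by (simp add: mat_dim_simps)
  have WT: "W\<^sup>T = W" unfolding W_def using dim MT by (simp add: mat_dim_simps)
  \<comment> \<open>J and \<open>L\<close> are both skew, so transposing
    \<open>W = J_mat k * L\<close> swaps the factors without a sign. The two factorizations together
    make \<open>W\<close> commute with J.\<close>
  then have LJ: "W = L * J_mat k"
    unfolding WL using dim L(2) by (simp add: mat_dim_simps)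
  have comm: "J_mat k * W = W * J_mat k"
    by (subst (2) LJ, subst WL) (use dim in \<open>simp add: mat_dim_simps\<close>)
  have "0 < w \<bullet> (W *\<^sub>v w)" if w: "w \<in> carrier_vec (2 * k)" "w \<noteq> 0\<^sub>v (2 * k)" for w
  proof -
    have Xc: "X \<in> carrier_mat (2 * n) (2 * k)" using dim by auto
    then have Xw: "X *\<^sub>v w \<in> carrier_vec (2 * n)" using w by auto
    have "W *\<^sub>v w = X\<^sup>T *\<^sub>v (M *\<^sub>v (X *\<^sub>v w))"
      unfolding W_def using Xc Mc w
      by (simp add: assoc_mult_mat_vec[of _ "2 * k" "2 * n" _ "2 * k"]
          assoc_mult_mat_vec[of _ "2 * n" "2 * n" _ "2 * k"])
    then have "w \<bullet> (W *\<^sub>v w) = (X *\<^sub>v w) \<bullet> (M *\<^sub>v (X *\<^sub>v w))"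
      using mult_mat_vec_adjoint[OF Xc w(1), of "M *\<^sub>v (X *\<^sub>v w)"] Xw Mc by simp
    \<comment> \<open>A symplectic \<open>X\<close> is injective: if it kills \<open>w\<close>, then
      so does \<open>J_mat k\<close>, which is invertible.\<close>
    moreover have "X *\<^sub>v w \<noteq> 0\<^sub>v (2 * n)"
    proof
      assume 0: "X *\<^sub>v w = 0\<^sub>v (2 * n)"
      have "J_mat k *\<^sub>v w = X\<^sup>T * J_mat n * X *\<^sub>v w" using XS by (simp add: Sp_def)
      also have "\<dots> = (X\<^sup>T * J_mat n) *\<^sub>v (X *\<^sub>v w)"
        using Xc w by (intro assoc_mult_mat_vec[of _ "2 * k" "2 * n" _ "2 * k"])
          (auto intro!: mult_carrier_mat[of _ _ "2 * n"])
      also have "\<dots> = 0\<^sub>v (2 * k)" unfolding 0 using Xc by (intro eq_vecI) auto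
      finally have "- w = J_mat k *\<^sub>v 0\<^sub>v (2 * k)" using J_mat_J_mat_vec[OF w(1)] by simp
      also have "\<dots> = 0\<^sub>v (2 * k)" by (intro eq_vecI) auto
      finally have "w = 0\<^sub>v (2 * k)" using uminus_uminus_vec[of w] by (auto simp: uminus_zero_vec_eq)
      with w(2) show False by simp
    qed
    ultimately show ?thesis using M Xw by (auto simp: sym_pos_def_def)
  qed
  with Wc WT have W: "sym_pos_def (2 * k) W" by (auto simp: sym_pos_def_def)
  obtain d where d: "symplectic_eigenvalues k W d" using williamson[OF W] .
  then obtain S where S: "S \<in> Sp k k" and D: "S\<^sup>T * W * S = double_diag k d"
    and pos: "\<forall>i<k. 0 < d i"
    unfolding symplectic_eigenvalues_def four_block_mat_diag_eq_double_diag by auto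
  note dim = dim SpD(1,2)[OF S]
  have SO: "S \<in> OrSp k" by (rule Sp_diagonalization_OrSp[OF W comm S D pos])
  \<comment> \<open>Since \<open>W = J_mat k * L\<close>, the eigenvector equation for
    \<open>W\<close> starts with J on both sides. Cancelling it shows that \<open>S\<close> brings
    the multiplier \<open>L\<close> to block form.\<close>
  have "J_mat k * (L * S) = J_mat k * (S * rotation_block k d)"
    using Sp_diagonalization_imp_eigen_eq[OF S Wc D] dim unfolding WL by (simp add: mat_dim_simps)
  then have "J_mat k * (J_mat k * (L * S)) = J_mat k * (J_mat k * (S * rotation_block k d))"
    by simp
  then have "- (L * S) = - (S * rotation_block k d)" using dim by (simp add: mat_dim_simps)
  then have LS: "L * S = S * rotation_block k d" by (metis uminus_uminus_mat)
  have "M * (X * S) = M * X * S" using dim by (simp add: mat_dim_simps)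
  also have "\<dots> = J_mat n * (X * (L * S))" unfolding L(3) using dim by (simp add: mat_dim_simps)
  also have "\<dots> = J_mat n * (X * S * rotation_block k d)"
    unfolding LS using dim by (simp add: mat_dim_simps)
  finally have MXS: "M * (X * S) = J_mat n * (X * S * rotation_block k d)" .
  have XSS: "X * S \<in> Sp k n" using Sp_mult[OF XS S] .
  have "M * (X * S) = J_mat n * (X * S) * rotation_block k d"
    unfolding MXS using dim by (simp add: mat_dim_simps)
  then have "normalized_symplectic_eigenvector_set_assoc k n M (X * S) d"
    using XSS unfolding normalized_symplectic_eigenvector_set_assoc_def rotation_block_def by blast
  \<comment> \<open>So far the \<open>d i\<close> are symplectic eigenvalues of the compressed
    matrix \<open>W\<close>; the equation \<open>MXS\<close> transfers them to
    \<open>M\<close>.\<close>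
  moreover have "\<forall>i<k. symplectic_eigenvalue n M (d i)"
    using symplectic_eigenvalueI[OF M XSS MXS] pos by blast
  ultimately show ?thesis using SO unfolding normalized_symplectic_eigenvector_set_def by blast
qed

text \<open>The skew matrix \<open>rotation_block k l\<close> itself serves as the
  multiplier.\<close>

lemma eigenvector_set_imp_critical_point:
  assumes "normalized_symplectic_eigenvector_set k n M X"
  shows "critical_point k n M X"
proof -
  obtain l where "X \<in> Sp k n" "M * X = J_mat n * X * rotation_block k l"
    using assms unfolding normalized_symplectic_eigenvector_set_def
      normalized_symplectic_eigenvector_set_assoc_def rotation_block_def by blast
  then show ?thesis
    unfolding critical_point_iff using rotation_block_transpose by (metis carrier_matI rotation_block_dim)
qed

theorem theorem4p3:
  fixes M :: "real mat" and n k :: nat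
  assumes "sym_pos_def (2 * n) M" and "1 \<le> k" and "k \<le> n"
  shows "(\<forall>X \<in> Sp k n. critical_point k n M X \<longrightarrow>
             (\<forall>K \<in> OrSp k. critical_point k n M (X * K))) \<and>
         (\<forall>X \<in> Sp k n. critical_point k n M X \<longleftrightarrow>
             (\<exists>K \<in> OrSp k. normalized_symplectic_eigenvector_set k n M (X * K)))"
proof -
  have M: "M \<in> carrier_mat (2 * n) (2 * n)" using assms(1) by (simp add: sym_pos_def_def)
  have "critical_point k n M X"
    if X: "X \<in> Sp k n" and K: "K \<in> OrSp k"
      and "normalized_symplectic_eigenvector_set k n M (X * K)" for X K
  proof -
    \<comment> \<open>The rotation is undone by applying part (i) to \<open>X * K\<close> and
      \<open>K\<^sup>T\<close>, which is again orthogonal and symplectic.\<close>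
    have "critical_point k n M (X * K * K\<^sup>T)"
      by (intro critical_point_mult_OrSp[OF M] eigenvector_set_imp_critical_point that(3)
          OrSp_transpose(2)[OF K])
    moreover have "X * K * K\<^sup>T = X"
    proof -
      have KS: "K \<in> Sp k k" using K by (simp add: OrSp_def)
      have "X * K * K\<^sup>T = X * (K * K\<^sup>T)" using SpD(1,2)[OF X] SpD(1,2)[OF KS]
        by (simp add: assoc_mult_mat_dim)
      then show ?thesis using SpD(1,2)[OF X] by (simp add: OrSp_transpose(1)[OF K])
    qed
    ultimately show ?thesis by simp
  qed
  then show ?thesis
    using critical_point_mult_OrSp[OF M] critical_point_imp_eigenvector_set[OF assms(1)] by blast
qed

end
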